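(* Let $A\in{\rm GL}(n)$ and let $\Delta\subset\mathbb{R}^n_q$ be a convex body with ${\rm Fix}(A)\cap{\rm Int}(\Delta)\ne\emptyset$. (i) If $\Delta$ contains a ball $B^{n}(\bar{q},r)$ with $A\bar{q}=\bar{q}$, then $$\xi^A(\Delta)\ge r\,c^{\Psi_A}_{\rm EHZ}(B^n\times B^n,\omega_0)\ge \frac{r\, \mathfrak{t}(\Psi_A)}{2}.$$ (ii) For any $u\in S^n_\Delta$, any $\bar{q}\in H_u$ and any ${\bf O}\in {\rm O}(n)$ such that ${\bf O}u=e_1=(1,0,\dots,0)\in\mathbb{R}^n$, let $$\Psi_{{\bf O}, \bar{q}}:\mathbb{R}^n_q\times \mathbb{R}^n_p\to \mathbb{R}^n_q\times\mathbb{R}^n_p,\quad (q, v)\mapsto ({\bf O}(q-\bar{q}), {\bf O}v).$$ Then $$\xi^A(\Delta)\le c_{\rm EHZ}^{\Psi_{{\bf O}, \bar{q}}\Psi_A\Psi_{{\bf O}, \bar{q}}^{-1}}(Z^{2n}_\Delta, \omega_0).$$ Moreover, the right-hand side is equal to $c_{\rm EHZ}^{\Psi_{{\bf O}}\Psi_A\Psi_{{\bf O}}^{-1}}(Z^{2n}_\Delta, \omega_0)$ if $A\bar{q}=\bar{q}$, and to $c_{\rm EHZ}^{\Psi_A}(Z^{2n}_\Delta, \omega_0)$ if $A\bar{q}=\bar{q}$ and $A{\bf O}={\bf O}A$.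
   Context: A convex body in $\mathbb{R}^m$ is a compact convex subset with nonempty interior. $B^n(x,r)$ is the open ball in $\mathbb{R}^n$ of center $x$ and radius $r>0$, and $B^n=B^n(0,1)$. ${\rm GL}(n)$ and ${\rm O}(n)$ are the invertible, resp. orthogonal, real $n\times n$ matrices; ${\rm Fix}$ denotes the fixed point set. On $\mathbb{R}^{2n}=\mathbb{R}^n_q\times\mathbb{R}^n_p$ with coordinates $(q,p)$ let $\omega_0=\sum_i dq_i\wedge dp_i$ and $J=\begin{pmatrix}0&-I_n\\ I_n&0\end{pmatrix}$. For $A\in{\rm GL}(n)$, $\Psi_A(q,v)=(Aq,(A^t)^{-1}v)$; in particular $\Psi_{\bf O}(q,v)=({\bf O}q,{\bf O}v)$ for ${\bf O}\in{\rm O}(n)$. Capacity: let $\Psi$ be a symplectomorphism of $(\mathbb{R}^{2n},\omega_0)$ and $O\subset\mathbb{R}^{2n}$ open with $O\cap{\rm Fix}(\Psi)\neq\emptyset$. Let $\mathcal{H}^\Psi(O)$ be the set of smooth $H:O\to\mathbb{R}$ such that (i) $H|_U=0$ for some nonempty open $U\subset O$ with $U\cap{\rm Fix}(\Psi)\ne\emptyset$; (ii) there is a compact $C\subset O$ with $H|_{O\setminus C}=m(H):=\max H$; (iii) $0\le H\le m(H)$. Let $X_H$ be defined by $\omega_0(X_H,\cdot)=-dH$. Such an $H$ is $\Psi$-admissible if for every $0<T\le1$ every solution $x:[0,T]\to O$ of $\dot x=X_H(x)$, $x(T)=\Psi x(0)$ is constant. Define $c^\Psi_{\rm HZ}(O,\omega_0)=\sup\{\max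 H : H\in\mathcal{H}^\Psi(O)\ \Psi\text{-admissible}\}$. For a convex set $D\subset\mathbb{R}^{2n}$ whose interior meets ${\rm Fix}(\Psi)$, $c^\Psi_{\rm EHZ}(D)=c^\Psi_{\rm EHZ}(D,\omega_0)$ denotes $c^\Psi_{\rm HZ}({\rm Int}(D),\omega_0)$. $\xi^A(\Delta):=c^{\Psi_A}_{\rm EHZ}(\Delta\times B^n)$. For $\Psi\in{\rm Sp}(2n,\mathbb{R})$, $\mathfrak{t}(\Psi)$ is the smallest $s\in(0,2\pi]$ with $\det(\Psi-e^{sJ})=0$ (the set of such $s$ is nonempty and finite). Width notation: $h_\Delta(u)=\sup_{x\in\Delta}\langle x,u\rangle$; $S^n=\{u\in\mathbb{R}^n : \|u\|=1\}$ (the paper's notation for the unit sphere of $\mathbb{R}^n$); ${\rm width}(\Delta)=\min\{h_\Delta(u)+h_\Delta(-u) : u\in S^n\}$; $S^n_\Delta=\{u\in S^n : {\rm width}(\Delta)=h_\Delta(u)+h_\Delta(-u)\}$; $H_u=\{x\in\mathbb{R}^n : \langle x,u\rangle=(h_\Delta(u)-h_\Delta(-u))/2\}$; $Z^{2n}_\Delta=([-{\rm width}(\Delta)/2,{\rm width}(\Delta)/2]\times\mathbb{R}^{n-1})\times([-1,1]\times\mathbb{R}^{n-1})\subset\mathbb{R}^n_q\times\mathbb{R}^n_p$. *)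

theory Defs
  imports "HOL-Analysis.Analysis"
begin

text \<open>The phase space R^{2n} = R^n_q x R^n_p is the product type of pairs (q, p), with
  the Euclidean structure of the product.\<close>

type_synonym 'n phase = "(real^'n) \<times> (real^'n)"

definition omega0 :: "'n::finite phase \<Rightarrow> 'n phase \<Rightarrow> real" where
  "omega0 z w = fst z \<bullet> snd w - snd z \<bullet> fst w"

definition Fix :: "('a \<Rightarrow> 'a) \<Rightarrow> 'a set" where
  "Fix f = {x. f x = x}"

text \<open>Only meant for open \<open>S\<close>: \<open>f\<close> is smooth if all iterated directional derivatives exist and
  are Frechet differentiable on \<open>S\<close>.\<close>

primrec higher_differentiable_on ::
  "'a::real_normed_vector set \<Rightarrow> ('a \<Rightarrow> 'b::real_normed_vector) \<Rightarrow> nat \<Rightarrow> bool" where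
  "higher_differentiable_on S f 0 \<longleftrightarrow> continuous_on S f"
| "higher_differentiable_on S f (Suc k) \<longleftrightarrow>
     (\<forall>x\<in>S. f differentiable (at x)) \<and>
     (\<forall>v. higher_differentiable_on S (\<lambda>x. frechet_derivative f (at x) v) k)"

definition smooth_on :: "'a::real_normed_vector set \<Rightarrow> ('a \<Rightarrow> 'b::real_normed_vector) \<Rightarrow> bool" where
  "smooth_on S f \<longleftrightarrow> (\<forall>k. higher_differentiable_on S f k)"

text \<open>A Hamiltonian \<open>H : W \<rightarrow> \<real>\<close> on an open set \<open>W\<close> is a total function whose values
  off \<open>W\<close> are never used. For members of \<open>hamiltonians\<close> below, the supremum
  \<open>ham_max W H\<close> is attained: a nonempty open \<open>W\<close> is not compact, so \<open>W - C\<close> is nonempty.\<close>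

definition ham_max :: "'n::finite phase set \<Rightarrow> ('n phase \<Rightarrow> real) \<Rightarrow> real" where
  "ham_max W H = (SUP x\<in>W. H x)"

definition hamiltonians :: "('n::finite phase \<Rightarrow> 'n phase) \<Rightarrow> 'n phase set \<Rightarrow> ('n phase \<Rightarrow> real) set" where
  "hamiltonians \<Psi> W = {H. smooth_on W H \<and>
     (\<exists>U. open U \<and> U \<subseteq> W \<and> U \<inter> Fix \<Psi> \<noteq> {} \<and> (\<forall>x\<in>U. H x = 0)) \<and>
     (\<exists>C. compact C \<and> C \<subseteq> W \<and> (\<forall>x\<in>W - C. H x = ham_max W H)) \<and>
     (\<forall>x\<in>W. 0 \<le> H x \<and> H x \<le> ham_max W H)}"

text \<open>The vector below exists and is unique where \<open>H\<close> is differentiable, as \<open>omega0\<close> is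
  nondegenerate; it is \<open>(- dH/dp, dH/dq)\<close>.\<close>

definition ham_vf :: "('n::finite phase \<Rightarrow> real) \<Rightarrow> 'n phase \<Rightarrow> 'n phase" where
  "ham_vf H x = (THE X. \<forall>w. omega0 X w = - frechet_derivative H (at x) w)"

definition admissible ::
  "('n::finite phase \<Rightarrow> 'n phase) \<Rightarrow> 'n phase set \<Rightarrow> ('n phase \<Rightarrow> real) \<Rightarrow> bool" where
  "admissible \<Psi> W H \<longleftrightarrow>
     (\<forall>T x. 0 < T \<and> T \<le> 1 \<and> x ` {0..T} \<subseteq> W \<and>
        (\<forall>t\<in>{0..T}. (x has_vector_derivative ham_vf H (x t)) (at t within {0..T})) \<and>
        x T = \<Psi> (x 0) \<longrightarrow>
        (\<forall>t\<in>{0..T}. x t = x 0))"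

text \<open>The capacities are extended reals, since the supremum may be infinite. They are meaningful
  for a symplectomorphism \<open>\<Psi>\<close> having a fixed point in \<open>W\<close>, resp. in the interior of \<open>D\<close>.\<close>

definition c_HZ :: "('n::finite phase \<Rightarrow> 'n phase) \<Rightarrow> 'n phase set \<Rightarrow> ereal" where
  "c_HZ \<Psi> W = (SUP H\<in>{H \<in> hamiltonians \<Psi> W. admissible \<Psi> W H}. ereal (ham_max W H))"

definition c_EHZ :: "('n::finite phase \<Rightarrow> 'n phase) \<Rightarrow> 'n phase set \<Rightarrow> ereal" where
  "c_EHZ \<Psi> D = c_HZ \<Psi> (interior D)"

definition Psi :: "real^'n^'n \<Rightarrow> 'n::finite phase \<Rightarrow> 'n phase" where
  "Psi A = (\<lambda>(q, v). (A *v q, matrix_inv (transpose A) *v v))"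

definition Psi_affine :: "real^'n^'n \<Rightarrow> real^'n \<Rightarrow> 'n::finite phase \<Rightarrow> 'n phase" where
  "Psi_affine Q qb = (\<lambda>(q, v). (Q *v (q - qb), Q *v v))"

definition xi :: "real^'n^'n \<Rightarrow> (real^'n::finite) set \<Rightarrow> ereal" where
  "xi A \<Delta> = c_EHZ (Psi A) (\<Delta> \<times> ball 0 1)"

text \<open>Square matrices of size 2n are indexed by the sum type \<open>'n + 'n\<close>: \<open>Inl\<close> for the
  q-coordinates, \<open>Inr\<close> for the p-coordinates.\<close>

definition to_coords :: "'n::finite phase \<Rightarrow> real^('n + 'n)" where
  "to_coords z = (\<chi> i. case i of Inl a \<Rightarrow> fst z $ a | Inr a \<Rightarrow> snd z $ a)"

definition of_coords :: "real^('n + 'n) \<Rightarrow> 'n::finite phase" where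
  "of_coords x = (\<chi> a. x $ Inl a, \<chi> a. x $ Inr a)"

definition phase_matrix :: "('n::finite phase \<Rightarrow> 'n phase) \<Rightarrow> real^('n + 'n)^('n + 'n)" where
  "phase_matrix F = matrix (\<lambda>x. to_coords (F (of_coords x)))"

definition J :: "'n::finite phase \<Rightarrow> 'n phase" where
  "J = (\<lambda>(q, p). (- p, q))"

primrec mat_power :: "real^'m^'m \<Rightarrow> nat \<Rightarrow> real^'m^'m" where
  "mat_power M 0 = mat 1"
| "mat_power M (Suc k) = M ** mat_power M k"

definition mat_exp :: "real^'m^'m \<Rightarrow> real^'m^'m" where
  "mat_exp M = (\<Sum>k. (1 / fact k) *\<^sub>R mat_power M k)"

definition tt :: "('n::finite phase \<Rightarrow> 'n phase) \<Rightarrow> real" where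
  "tt F = (LEAST s. s \<in> {0<..2 * pi} \<and>
             det (phase_matrix F - mat_exp (s *\<^sub>R phase_matrix J)) = 0)"

definition convex_body :: "'a::euclidean_space set \<Rightarrow> bool" where
  "convex_body K \<longleftrightarrow> compact K \<and> convex K \<and> interior K \<noteq> {}"

definition support_fun :: "'a::euclidean_space set \<Rightarrow> 'a \<Rightarrow> real" where
  "support_fun \<Delta> u = (SUP x\<in>\<Delta>. x \<bullet> u)"

text \<open>The infimum is a minimum for a convex body, since its support function is continuous.\<close>

definition width :: "'a::euclidean_space set \<Rightarrow> real" where
  "width \<Delta> = (INF u\<in>sphere 0 1. support_fun \<Delta> u + support_fun \<Delta> (- u))"

definition width_directions :: "'a::euclidean_space set \<Rightarrow> 'a set" where
  "width_directions \<Delta> = {u \<in> sphere 0 1. width \<Delta> = support_fun \<Delta> u + support_fun \<Delta> (- u)}"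

definition mid_hyperplane :: "'a::euclidean_space set \<Rightarrow> 'a \<Rightarrow> 'a set" where
  "mid_hyperplane \<Delta> u = {x. x \<bullet> u = (support_fun \<Delta> u - support_fun \<Delta> (- u)) / 2}"

text \<open>The index type of R^n carries no distinguished first element; \<open>i1\<close> is the index that
  plays the role of the first coordinate, so that \<open>e_1\<close> is \<open>axis i1 1\<close>.\<close>

definition Z_cyl :: "'n \<Rightarrow> (real^'n) set \<Rightarrow> 'n::finite phase set" where
  "Z_cyl i1 \<Delta> = {q. q $ i1 \<in> {- width \<Delta> / 2..width \<Delta> / 2}} \<times> {p. p $ i1 \<in> {-1..1}}"

end

theory Submission
  imports Defs
begin

text \<open>
  Two mechanisms drive the proof. A Hamiltonian that is admissible on an open set extends by its
  maximum to any larger one, and an affine map whose linear part multiplies \<open>omega0\<close> by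
  \<open>\<kappa> > 0\<close> carries admissible Hamiltonians to admissible Hamiltonians of \<open>\<kappa>\<close> times the size.
  Applied to \<open>(q, p) \<mapsto> (r q + qb, p)\<close>, which commutes with \<open>Psi A\<close> when \<open>A qb = qb\<close>, they give the
  first bound of (i); applied to \<open>Psi_affine Q qb\<close>, which maps the product into the cylinder, the
  bound of (ii).

  For the second bound of (i), a Hamiltonian \<open>f(|z|^2)\<close> flows by the rotation \<open>e\<^bsup>sJ\<^esup>\<close> with
  \<open>s = 2 t f'(|z|^2)\<close>. As long as \<open>2 f' < tt (Psi A)\<close>, a nonconstant trajectory that closes up to
  \<open>Psi A\<close> in time at most 1 would give a zero of the determinant in \<open>tt\<close> below the least one; and
  \<open>f\<close> can rise from 0 to nearly \<open>tt (Psi A) / 2\<close> on the unit interval.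
\<close>

section \<open>Smooth functions\<close>

text \<open>On an open set, equality holds near each point, so it passes to the Frechet derivatives
  and the induction can be applied to them.\<close>

lemma higher_differentiable_on_cong:
  assumes "open S" "\<And>x. x \<in> S \<Longrightarrow> f x = g x" "higher_differentiable_on S f k"
  shows "higher_differentiable_on S g k"
  using assms(2,3)
proof (induction k arbitrary: f g)
  case 0
  then show ?case using continuous_on_cong by fastforce
next
  case (Suc k)
  have d: "(g has_derivative frechet_derivative f (at x)) (at x)" if "x \<in> S" for x
  proof -
    have "(f has_derivative frechet_derivative f (at x)) (at x)"
      using Suc.prems(2) that by (simp add: frechet_derivative_works)
    then show ?thesis
      using has_derivative_transform_within_open[OF _ assms(1) that] Suc.prems(1) by blast
  qed
  have "higher_differentiable_on S (\<lambda>x. frechet_derivative g (at x) v) k" for v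
  proof (rule Suc.IH)
    show "frechet_derivative f (at x) v = frechet_derivative g (at x) v" if "x \<in> S" for x
      using frechet_derivative_at[OF d[OF that]] by simp
  qed (use Suc.prems(2) in auto)
  then show ?case using d by (auto simp: differentiable_def)
qed

text \<open>This glues a Hamiltonian to its constant extension. Derivatives are taken at a point and
  not within the set, so only continuity in the base case needs an argument.\<close>

lemma higher_differentiable_on_Un:
  "open S \<Longrightarrow> open T \<Longrightarrow> higher_differentiable_on S f k \<Longrightarrow> higher_differentiable_on T f k
    \<Longrightarrow> higher_differentiable_on (S \<union> T) f k"
  by (induction k arbitrary: f) (auto intro: continuous_on_open_Un)

text \<open>An explicit formula for the derivative replaces the choice term
  \<open>frechet_derivative\<close>; the inductive steps below go through this rule.\<close>

lemma higher_differentiable_on_SucI: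
  assumes "open S" "\<And>x. x \<in> S \<Longrightarrow> (f has_derivative f' x) (at x)"
    and "\<And>v. higher_differentiable_on S (\<lambda>x. f' x v) k"
  shows "higher_differentiable_on S f (Suc k)"
proof -
  have "higher_differentiable_on S (\<lambda>x. frechet_derivative f (at x) v) k" for v
    by (rule higher_differentiable_on_cong[OF assms(1) _ assms(3)[of v]])
      (metis assms(2) frechet_derivative_at)
  then show ?thesis using assms(2) by (auto simp: differentiable_def)
qed

lemma higher_differentiable_on_Suc_imp:
  "higher_differentiable_on S f (Suc k) \<Longrightarrow> higher_differentiable_on S f k"
proof (induction k arbitrary: f)
  case 0
  then show ?case
    by (auto intro!: continuous_at_imp_continuous_on differentiable_imp_continuous_within)
next
  case (Suc k)
  then show ?case by (metis higher_differentiable_on.simps(2))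
qed

lemma higher_differentiable_on_const: "open S \<Longrightarrow> higher_differentiable_on S (\<lambda>x. c) k"
proof (induction k arbitrary: c)
  case (Suc k)
  show ?case
    by (rule higher_differentiable_on_SucI[where f' = "\<lambda>x v. 0"]) (use Suc in auto)
qed auto

lemma higher_differentiable_on_bounded_linear:
  "open S \<Longrightarrow> bounded_linear f \<Longrightarrow> higher_differentiable_on S f k"
proof (cases k)
  case (Suc l)
  assume a: "open S" "bounded_linear f"
  show ?thesis
    unfolding Suc
    by (rule higher_differentiable_on_SucI[where f' = "\<lambda>x. f"])
      (use a in \<open>auto intro: higher_differentiable_on_const bounded_linear_imp_has_derivative\<close>)
qed (auto intro: linear_continuous_on)

lemma higher_differentiable_on_add:
  assumes "open S"
  shows "higher_differentiable_on S f k \<Longrightarrow> higher_differentiable_on S g k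
    \<Longrightarrow> higher_differentiable_on S (\<lambda>x. f x + g x) k"
proof (induction k arbitrary: f g)
  case (Suc k)
  show ?case
    by (rule higher_differentiable_on_SucI
          [where f' = "\<lambda>x v. frechet_derivative f (at x) v + frechet_derivative g (at x) v"])
      (use Suc assms in \<open>auto intro!: has_derivative_add simp: frechet_derivative_works\<close>)
qed (auto intro: continuous_intros)

lemma higher_differentiable_on_mult:
  fixes f g :: "'a::real_normed_vector \<Rightarrow> real"
  assumes "open S"
  shows "higher_differentiable_on S f k \<Longrightarrow> higher_differentiable_on S g k
    \<Longrightarrow> higher_differentiable_on S (\<lambda>x. f x * g x) k"
proof (induction k arbitrary: f g)
  case (Suc k)
  \<comment> \<open>The product rule keeps one factor undifferentiated, so \<open>f\<close> and
    \<open>g\<close> themselves are also needed at order \<open>k\<close>.\<close>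
  have "higher_differentiable_on S f k" "higher_differentiable_on S g k"
    using Suc.prems higher_differentiable_on_Suc_imp by blast+
  then show ?case
    by (intro higher_differentiable_on_SucI
          [where f' = "\<lambda>x v. f x * frechet_derivative g (at x) v + frechet_derivative f (at x) v * g x"])
      (use Suc assms in \<open>auto intro!: has_derivative_mult higher_differentiable_on_add
        simp: frechet_derivative_works\<close>)
qed (auto intro: continuous_intros)

text \<open>The derivative in direction \<open>v\<close> is that of \<open>f\<close> in the fixed
  direction \<open>L v\<close>, composed with the same affine map. The composite keeps its form and
  the induction closes.\<close>

lemma higher_differentiable_on_comp_affine:
  assumes "open S" "bounded_linear L"
  shows "higher_differentiable_on S f k
    \<Longrightarrow> higher_differentiable_on ((\<lambda>x. L x + c) -` S) (\<lambda>x. f (L x + c)) k"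
proof (induction k arbitrary: f)
  case 0
  have "continuous_on ((\<lambda>x. L x + c) -` S) (\<lambda>x. L x + c)"
    by (intro continuous_on_add continuous_on_const linear_continuous_on assms)
  then show ?case
    using 0 continuous_on_compose2[of S f _ "\<lambda>x. L x + c"] by auto
next
  case (Suc k)
  have o: "open ((\<lambda>x. L x + c) -` S)"
    by (rule open_vimage[OF assms(1)])
      (intro continuous_on_add continuous_on_const linear_continuous_on assms)
  have "((\<lambda>x. f (L x + c)) has_derivative (\<lambda>v. frechet_derivative f (at (L x + c)) (L v))) (at x)"
    if "L x + c \<in> S" for x
  proof -
    have "(f has_derivative frechet_derivative f (at (L x + c))) (at (L x + c))"
      using Suc.prems that by (simp add: frechet_derivative_works)
    moreover have "((\<lambda>x. L x + c) has_derivative L) (at x)"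
      by (intro has_derivative_add_const bounded_linear_imp_has_derivative assms)
    ultimately show ?thesis
      using has_derivative_compose[of "\<lambda>x. L x + c" L x UNIV f] by simp
  qed
  then show ?case
    using Suc by (intro higher_differentiable_on_SucI[OF o]) auto
qed

text \<open>Each derivative is again a function of \<open>x \<bullet> x\<close> times a linear
  function of \<open>x\<close>, so the product rule suffices for the induction.\<close>

lemma higher_differentiable_on_comp_inner_self:
  fixes f :: "real \<Rightarrow> real" and S :: "'a::real_inner set"
  assumes "open S"
  shows "higher_differentiable_on UNIV f k \<Longrightarrow> higher_differentiable_on S (\<lambda>x. f (x \<bullet> x)) k"
proof (induction k arbitrary: f)
  case 0
  then show ?case by (auto intro!: continuous_on_compose2[of UNIV f] continuous_intros)
next
  case (Suc k)
  have "((\<lambda>x. f (x \<bullet> x)) has_derivative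
      (\<lambda>v. frechet_derivative f (at (x \<bullet> x)) 1 * (2 * (x \<bullet> v)))) (at x)" for x :: 'a
  proof -
    let ?D = "frechet_derivative f (at (x \<bullet> x))"
    have D: "(f has_derivative ?D) (at (x \<bullet> x))"
      using Suc.prems by (simp add: frechet_derivative_works)
    have "((\<lambda>x. x \<bullet> x) has_derivative (\<lambda>v. 2 * (x \<bullet> v))) (at x)"
      by (auto intro!: derivative_eq_intros simp: inner_commute)
    from has_derivative_compose[OF this D]
    have "((\<lambda>x. f (x \<bullet> x)) has_derivative (\<lambda>v. ?D (2 * (x \<bullet> v)))) (at x)" .
    moreover have "?D = (\<lambda>t. ?D 1 * t)"
    proof
      fix t
      show "?D t = ?D 1 * t"
        using linear_scale[OF has_derivative_linear[OF D], of t 1]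
        by (metis mult.commute mult.right_neutral real_scaleR_def)
    qed
    ultimately show ?thesis by metis
  qed
  moreover have "higher_differentiable_on S (\<lambda>x. frechet_derivative f (at (x \<bullet> x)) 1 * (2 * (x \<bullet> v))) k"
    for v
  proof (rule higher_differentiable_on_mult[OF assms])
    show "higher_differentiable_on S (\<lambda>x. frechet_derivative f (at (x \<bullet> x)) 1) k"
      by (rule Suc.IH) (use Suc.prems in auto)
    show "higher_differentiable_on S (\<lambda>x. 2 * (x \<bullet> v)) k"
      by (intro higher_differentiable_on_bounded_linear[OF assms]
          bounded_linear_const_mult bounded_linear_inner_left)
  qed
  ultimately show ?case by (intro higher_differentiable_on_SucI[OF assms]) auto
qed

lemma higher_differentiable_on_real_SucI:
  fixes f :: "real \<Rightarrow> real"
  assumes "\<And>x. (f has_real_derivative f' x) (at x)" "higher_differentiable_on UNIV f' k"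
  shows "higher_differentiable_on UNIV f (Suc k)"
proof (rule higher_differentiable_on_SucI)
  show "(f has_derivative (*) (f' x)) (at x)" for x
    using assms(1) by (simp add: has_field_derivative_def)
  show "higher_differentiable_on UNIV (\<lambda>x. f' x * v) k" for v
    by (intro higher_differentiable_on_mult assms higher_differentiable_on_const) auto
qed auto

lemma smooth_on_antiderivative:
  fixes f :: "real \<Rightarrow> real"
  assumes "\<And>x. (f has_real_derivative f' x) (at x)" "smooth_on UNIV f'"
  shows "smooth_on UNIV f"
  unfolding smooth_on_def
proof
  fix k
  show "higher_differentiable_on UNIV f k"
    using higher_differentiable_on_real_SucI[of f f'] assms higher_differentiable_on_Suc_imp
    unfolding smooth_on_def by blast
qed

lemma smooth_on_comp_real_affine:
  fixes f :: "real \<Rightarrow> real"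
  assumes "smooth_on UNIV f"
  shows "smooth_on UNIV (\<lambda>x. f (a * x + c))"
  using higher_differentiable_on_comp_affine[OF open_UNIV bounded_linear_mult_right, of f _ a c] assms
  by (auto simp: smooth_on_def)

lemma smooth_on_mult:
  fixes f g :: "'a::real_normed_vector \<Rightarrow> real"
  assumes "open S" "smooth_on S f" "smooth_on S g"
  shows "smooth_on S (\<lambda>x. f x * g x)"
  using assms higher_differentiable_on_mult unfolding smooth_on_def by blast

lemma smooth_on_const: "open S \<Longrightarrow> smooth_on S (\<lambda>x. c)"
  by (simp add: smooth_on_def higher_differentiable_on_const)

lemma smooth_on_imp_continuous_on: "smooth_on S f \<Longrightarrow> continuous_on S f"
  unfolding smooth_on_def by (metis higher_differentiable_on.simps(1))

lemma smooth_on_imp_differentiable: "smooth_on S f \<Longrightarrow> x \<in> S \<Longrightarrow> f differentiable (at x)"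
  unfolding smooth_on_def by (metis higher_differentiable_on.simps(2))

section \<open>Flat functions, smooth steps and ramps on the real line\<close>

text \<open>Substituting \<open>y = 1 / x\<close> reduces this to the exponential outgrowing every
  power at infinity.\<close>

lemma poly_inverse_exp_tendsto_0:
  "((\<lambda>x. poly p (1 / x) * exp (- (1 / x))) \<longlongrightarrow> 0) (at_right (0::real))"
proof -
  have "((\<lambda>y. \<Sum>i\<le>degree p. coeff p i * (y ^ i / exp y)) \<longlongrightarrow> 0) at_top"
    by (intro tendsto_null_sum tendsto_mult_right_zero tendsto_power_div_exp_0)
  then have "((\<lambda>y. poly p y * exp (- y)) \<longlongrightarrow> 0) at_top"
    by (simp add: poly_altdef exp_minus sum_distrib_right divide_inverse mult.assoc)
  moreover have "filterlim (\<lambda>x::real. 1 / x) at_top (at_right 0)"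
    using filterlim_inverse_at_top_right by (simp add: divide_inverse)
  ultimately show ?thesis by (rule filterlim_compose)
qed

text \<open>The polynomial factor makes this family closed under differentiation.\<close>
definition flat_exp :: "real poly \<Rightarrow> real \<Rightarrow> real" where
  "flat_exp p x = (if x > 0 then poly p (1 / x) * exp (- (1 / x)) else 0)"

text \<open>For positive \<open>x\<close> the inner derivative of \<open>1 / x\<close> contributes
  the factor \<open>1 / x^2\<close>, which is the \<open>monom 1 2\<close>. The only delicate point
  is 0, where the difference quotient must tend to 0.\<close>

lemma flat_exp_has_derivative:
  "(flat_exp p has_real_derivative flat_exp (monom 1 2 * (p - pderiv p)) x) (at x)"
proof -
  consider "x < 0" | "x > 0" | "x = 0" by linarith
  then show ?thesis
  proof cases
    case 1
    have "((\<lambda>x. 0) has_real_derivative 0) (at x)" by simp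
    then have "(flat_exp p has_real_derivative 0) (at x)"
      by (rule has_field_derivative_transform_within_open[where S = "{..<0}"])
        (use 1 in \<open>auto simp: flat_exp_def\<close>)
    then show ?thesis using 1 by (simp add: flat_exp_def)
  next
    case 2
    have "((\<lambda>x. poly p (1 / x) * exp (- (1 / x))) has_real_derivative
        flat_exp (monom 1 2 * (p - pderiv p)) x) (at x)"
      using 2
      by (auto intro!: derivative_eq_intros DERIV_chain2[OF poly_DERIV]
          simp: flat_exp_def poly_monom field_simps power2_eq_square)
    then show ?thesis
      by (rule has_field_derivative_transform_within_open[where S = "{0<..}"])
        (use 2 in \<open>auto simp: flat_exp_def\<close>)
  next
    case 3
    \<comment> \<open>Dividing by \<open>y\<close> multiplies the polynomial in \<open>1 / y\<close>
      by its variable, that is, replaces \<open>p\<close> by \<open>pCons 0 p\<close>.\<close>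
    have "((\<lambda>y. flat_exp p y / y) \<longlongrightarrow> 0) (at_right 0)"
      by (rule Lim_transform_eventually[OF poly_inverse_exp_tendsto_0[of "pCons 0 p"]])
        (auto simp: flat_exp_def eventually_at_filter)
    moreover have "((\<lambda>y. flat_exp p y / y) \<longlongrightarrow> 0) (at_left 0)"
      by (rule Lim_transform_eventually[OF tendsto_const])
        (auto simp: flat_exp_def eventually_at_filter)
    ultimately have "((\<lambda>y. flat_exp p y / y) \<longlongrightarrow> 0) (at 0)"
      by (simp add: filterlim_split_at)
    then show ?thesis using 3 by (simp add: has_field_derivative_iff flat_exp_def)
  qed
qed

lemma smooth_on_flat_exp: "smooth_on UNIV (flat_exp p)"
proof -
  have "higher_differentiable_on UNIV (flat_exp p) k" for k
  proof (induction k arbitrary: p)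
    case 0
    then show ?case
      using flat_exp_has_derivative
      by (auto intro!: continuous_at_imp_continuous_on intro: DERIV_isCont)
  next
    case (Suc k)
    show ?case
      by (rule higher_differentiable_on_real_SucI[OF flat_exp_has_derivative Suc.IH])
  qed
  then show ?thesis by (simp add: smooth_on_def)
qed

lemma antiderivative_of_vanishing_left:
  fixes g :: "real \<Rightarrow> real"
  assumes "continuous_on UNIV g" "\<And>x. x \<le> 0 \<Longrightarrow> g x = 0"
  obtains F where "\<And>x. (F has_real_derivative g x) (at x)" "\<And>x. x \<le> 0 \<Longrightarrow> F x = 0"
proof
  \<comment> \<open>For negative \<open>x\<close> the interval is empty and the integral 0, the
    right value because \<open>g\<close> vanishes there.\<close>
  let ?F = "\<lambda>x. integral {0..x} g"
  have int: "g integrable_on {a..b}" for a b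
    by (intro integrable_continuous_real continuous_on_subset[OF assms(1)]) auto
  show F0: "?F x = 0" if "x \<le> 0" for x
    using that by (cases "x = 0") auto
  show "(?F has_real_derivative g x) (at x)" for x
  proof -
    \<comment> \<open>A base point to the left of both 0 and \<open>x\<close>: integrals from
      \<open>a\<close> and from 0 agree, and \<open>x\<close> is interior to
      \<open>{a..x + 1}\<close>, so the derivative within that interval is a full
      derivative.\<close>
    define a where "a = - \<bar>x\<bar> - 1"
    have "((\<lambda>u. integral {a..u} g) has_real_derivative g x) (at x within {a..x + 1})"
      by (rule integral_has_real_derivative) (auto simp: a_def intro: continuous_on_subset[OF assms(1)])
    moreover have "at x within {a..x + 1} = at x"
      by (rule at_within_interior) (auto simp: a_def)
    ultimately have "((\<lambda>u. integral {a..u} g) has_real_derivative g x) (at x)" by simp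
    then show ?thesis
    proof (rule has_field_derivative_transform_within_open[where S = "{a<..}"])
      fix u assume "u \<in> {a<..}"
      then have u: "a < u" by simp
      have z: "integral {a..t} g = 0" if "t \<le> 0" for t
        using that assms(2) integral_cong[of "{a..t}" g "\<lambda>_. 0"] by simp
      show "integral {a..u} g = ?F u"
      proof (cases "u \<le> 0")
        case True
        then show ?thesis using z F0 by simp
      next
        case False
        have "integral {a..0} g + integral {0..u} g = integral {a..u} g"
          by (rule Henstock_Kurzweil_Integration.integral_combine[OF _ _ int])
            (use False a_def in auto)
        then show ?thesis using z[of 0] by simp
      qed
    qed (auto simp: a_def)
  qed
qed

text \<open>The step is the normalized primitive of a bump \<open>b\<close> that is positive exactly
  on the open unit interval, namely \<open>exp (- 1 / x)\<close> times its mirror image about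
  1/2.\<close>

lemma smooth_step_exists:
  obtains s :: "real \<Rightarrow> real" where "smooth_on UNIV s" "\<And>x. x \<le> 0 \<Longrightarrow> s x = 0"
    "\<And>x. 1 \<le> x \<Longrightarrow> s x = 1" "\<And>x. 0 \<le> s x" "\<And>x. s x \<le> 1"
proof -
  define b where "b x = flat_exp 1 x * flat_exp 1 (1 - x)" for x
  have sm: "smooth_on UNIV b"
    unfolding b_def using smooth_on_comp_real_affine[OF smooth_on_flat_exp, of 1 "-1" 1]
    by (intro smooth_on_mult smooth_on_flat_exp) auto
  have b0: "b x \<ge> 0" and bz: "x \<le> 0 \<or> x \<ge> 1 \<Longrightarrow> b x = 0"
    and bp: "0 < x \<Longrightarrow> x < 1 \<Longrightarrow> b x > 0" for x
    by (auto simp: b_def flat_exp_def)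
  obtain F where F: "\<And>x. (F has_real_derivative b x) (at x)" "\<And>x. x \<le> 0 \<Longrightarrow> F x = 0"
    using antiderivative_of_vanishing_left[OF smooth_on_imp_continuous_on[OF sm]] bz by blast
  have mono: "F x \<le> F y" if "x \<le> y" for x y
    by (rule DERIV_nonneg_imp_nondecreasing[OF that]) (use F b0 in blast)
  have F1: "F x = F 1" if "x \<ge> 1" for x
  proof (cases "x = 1")
    case False
    then have "1 < x" using that by simp
    then obtain z where "1 < z" "z < x" "F x - F 1 = (x - 1) * b z"
      using MVT2[of 1 x F b] F by blast
    then show ?thesis using bz[of z] by simp
  qed simp
  obtain z where "0 < z" "z < 1" "F 1 - F 0 = (1 - 0) * b z"
    using MVT2[of 0 1 F b] F by force
  then have pos: "F 1 > 0" using bp F(2)[of 0] by simp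
  show ?thesis
  proof
    have "smooth_on UNIV F" by (rule smooth_on_antiderivative[OF F(1) sm])
    then show "smooth_on UNIV (\<lambda>x. F x * inverse (F 1))"
      by (intro smooth_on_mult smooth_on_const) auto
    show "F x * inverse (F 1) \<le> 1" for x
      using mono[of x 1] F1[of x] pos by (cases "x \<le> 1") (auto simp: field_simps)
    show "0 \<le> F x * inverse (F 1)" for x
      using mono[of 0 x] F(2)[of x] F(2)[of 0] pos by (cases "x \<le> 0") (auto simp: field_simps)
    show "F x * inverse (F 1) = 0" if "x \<le> 0" for x
      using F(2)[OF that] by simp
    show "F x * inverse (F 1) = 1" if "1 \<le> x" for x
      using F1[OF that] pos by simp
  qed
qed

text \<open>This is the profile of the radial Hamiltonian. Its slope is \<open>a\<close> on a
  plateau of length \<open>1 - 4 * e\<close> and never larger, so the rise is almost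
  \<open>a\<close>, while both ends are flat.\<close>

lemma smooth_ramp_exists:
  fixes a e :: real
  assumes "0 \<le> a" "0 < e" "4 * e < 1"
  obtains f f' :: "real \<Rightarrow> real" where "smooth_on UNIV f"
    "\<And>x. (f has_real_derivative f' x) (at x)" "\<And>x. 0 \<le> f' x" "\<And>x. f' x \<le> a"
    "\<And>x. x \<le> e \<Longrightarrow> f x = 0" "\<And>x. 1 - e \<le> x \<Longrightarrow> f x = f 1" "a * (1 - 4 * e) \<le> f 1"
proof -
  obtain s :: "real \<Rightarrow> real" where s: "smooth_on UNIV s" "\<And>x. x \<le> 0 \<Longrightarrow> s x = 0"
    "\<And>x. 1 \<le> x \<Longrightarrow> s x = 1" "\<And>x. 0 \<le> s x" "\<And>x. s x \<le> 1"
    using smooth_step_exists by blast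
  \<comment> \<open>The first factor climbs on \<open>[e, 2 * e]\<close>, the second descends on
    \<open>[1 - 2 * e, 1 - e]\<close>. The arguments have the shape that
    \<open>smooth_on_comp_real_affine\<close> expects.\<close>
  define g where "g x = a * (s (inverse e * x + (- 1)) * s (- inverse e * x + (1 / e - 1)))" for x
  have sm: "smooth_on UNIV g"
    unfolding g_def
    by (intro smooth_on_mult smooth_on_const smooth_on_comp_real_affine s) auto
  have g_eq: "g x = a * (s ((x - e) / e) * s ((1 - e - x) / e))" for x
  proof -
    have "inverse e * x + (- 1) = (x - e) / e" "- inverse e * x + (1 / e - 1) = (1 - e - x) / e"
      using assms by (auto simp: divide_simps)
    then show ?thesis by (simp only: g_def)
  qed
  have gz: "g x = 0" if "x \<le> e \<or> x \<ge> 1 - e" for x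
  proof -
    have "(x - e) / e \<le> 0 \<or> (1 - e - x) / e \<le> 0"
      using that assms by (auto simp: divide_le_0_iff)
    then show ?thesis using s(2) by (auto simp: g_eq)
  qed
  have ga: "g x = a" if "2 * e \<le> x" "x \<le> 1 - 2 * e" for x
  proof -
    have "(x - e) / e \<ge> 1" "(1 - e - x) / e \<ge> 1"
      using that assms by (auto simp: le_divide_eq)
    then show ?thesis using s(3) by (auto simp: g_eq)
  qed
  have g0: "0 \<le> g x" and g1: "g x \<le> a" for x
    using assms s(4,5) by (auto simp: g_def intro!: mult_left_le mult_le_one)
  obtain f where f: "\<And>x. (f has_real_derivative g x) (at x)" "\<And>x. x \<le> 0 \<Longrightarrow> f x = 0"
    using antiderivative_of_vanishing_left[OF smooth_on_imp_continuous_on[OF sm]] gz assms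
    by (metis dual_order.trans less_imp_le)
  have mono: "f x \<le> f y" if "x \<le> y" for x y
    by (rule DERIV_nonneg_imp_nondecreasing[OF that]) (use f g0 in blast)
  have const: "f x = f y" if "x < y" "\<And>z. x < z \<Longrightarrow> z < y \<Longrightarrow> g z = 0" for x y
    using MVT2[of x y f g] f that by force
  show ?thesis
  proof
    show "smooth_on UNIV f" by (rule smooth_on_antiderivative[OF f(1) sm])
    show "f x = 0" if "x \<le> e" for x
    proof (cases "x \<le> 0")
      case False
      then have "f 0 = f x" using that by (intro const gz) auto
      then show ?thesis using f(2)[of 0] by simp
    qed (rule f(2))
    show "f x = f 1" if "1 - e \<le> x" for x
    proof (cases x "1::real" rule: linorder_cases)
      case less
      then show ?thesis using that by (intro const gz) auto
    next
      case greater
      then show ?thesis using assms by (intro const[symmetric] gz) auto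
    qed simp
    have "\<exists>z. 2 * e < z \<and> z < 1 - 2 * e \<and> f (1 - 2 * e) - f (2 * e) = (1 - 2 * e - 2 * e) * g z"
      using MVT2[of "2 * e" "1 - 2 * e" f g] f assms by force
    then have "f (1 - 2 * e) - f (2 * e) = (1 - 4 * e) * a"
      using ga by (auto simp: algebra_simps)
    moreover have "0 \<le> f (2 * e)" "f (1 - 2 * e) \<le> f 1"
      using mono[of 0 "2 * e"] mono[of "1 - 2 * e" 1] f(2)[of 0] assms by auto
    ultimately show "a * (1 - 4 * e) \<le> f 1" by (simp add: algebra_simps)
  qed (rule f(1) g0 g1)+
qed

section \<open>Monotonicity and conformality of the capacity\<close>

lemma bounded_bilinear_omega0: "bounded_bilinear (omega0 :: 'n::finite phase \<Rightarrow> _)"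
  unfolding bilinear_conv_bounded_bilinear[symmetric] bilinear_def omega0_def
  by (auto intro!: linearI simp: algebra_simps inner_add_left inner_add_right inner_diff_left)

lemma omega0_nondegenerate:
  assumes "\<And>w. omega0 X w = omega0 Y w"
  shows "X = Y"
proof -
  have "(fst X - fst Y) \<bullet> v = 0" "(snd X - snd Y) \<bullet> v = 0" for v
    using assms[of "(0, v)"] assms[of "(v, 0)"] by (auto simp: omega0_def inner_diff_left)
  then have "fst X - fst Y = 0" "snd X - snd Y = 0"
    using inner_eq_zero_iff by blast+
  then show ?thesis by (simp add: prod_eq_iff)
qed

lemma ham_vf_eqI:
  assumes "\<And>w. omega0 X w = - frechet_derivative H (at x) w"
  shows "ham_vf H x = X"
  unfolding ham_vf_def
  by (rule the_equality) (use assms omega0_nondegenerate in \<open>metis\<close>)+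

text \<open>As \<open>ham_vf\<close> is a \<open>THE\<close> term, a vector solving its equation
  must be exhibited: it is the gradient \<open>adjoint ?d 1\<close> turned by
  \<open>J\<close>.\<close>

lemma omega0_ham_vf:
  assumes "H differentiable (at x)"
  shows "omega0 (ham_vf H x) w = - frechet_derivative H (at x) w"
proof -
  let ?d = "frechet_derivative H (at x)"
  have "linear ?d"
    using assms linear_frechet_derivative by blast
  then have d: "?d w = w \<bullet> adjoint ?d 1" for w
    using adjoint_works[of ?d w 1] by simp
  define X where "X = (- snd (adjoint ?d 1), fst (adjoint ?d 1))"
  have X: "omega0 X w = - ?d w" for w
    by (subst d) (simp add: X_def omega0_def inner_prod_def inner_commute)
  then have "ham_vf H x = X" by (rule ham_vf_eqI)
  then show ?thesis using X by metis
qed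

lemma ham_vf_cong:
  assumes "open S" "x \<in> S" "\<And>y. y \<in> S \<Longrightarrow> H y = K y"
  shows "ham_vf H x = ham_vf K x"
proof -
  have "(H has_derivative D) (at x) \<longleftrightarrow> (K has_derivative D) (at x)" for D
    using has_derivative_transform_within_open[OF _ assms(1,2), of H D UNIV K]
      has_derivative_transform_within_open[OF _ assms(1,2), of K D UNIV H] assms(3) by force
  then have "frechet_derivative H (at x) = frechet_derivative K (at x)"
    by (simp add: frechet_derivative_def)
  then show ?thesis by (simp add: ham_vf_def)
qed

lemma ham_vf_const: "ham_vf (\<lambda>x. c) x = 0"
  by (rule ham_vf_eqI) (simp add: omega0_def)

text \<open>Uniqueness of solutions is not needed: since the field vanishes near \<open>x t0\<close>, the set of
  times at which the curve sits at \<open>x t0\<close> is open and closed in the interval.\<close>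
lemma integral_curve_const:
  fixes x :: "real \<Rightarrow> 'a::real_normed_vector"
  assumes deriv: "\<And>t. t \<in> {0..T} \<Longrightarrow> (x has_vector_derivative X (x t)) (at t within {0..T})"
    and "open N" "\<And>y. y \<in> N \<Longrightarrow> X y = 0" "t0 \<in> {0..T}" "x t0 \<in> N" "t \<in> {0..T}"
  shows "x t = x t0"
proof -
  have cont: "continuous_on {0..T} x"
    using deriv has_vector_derivative_continuous continuous_on_eq_continuous_within by blast
  let ?E = "{0..T} \<inter> x -` {x t0}"
  have "openin (top_of_set {0..T}) ?E"
    unfolding openin_euclidean_subtopology_iff
  proof (intro conjI ballI)
    fix t assume t: "t \<in> ?E"
    have "openin (top_of_set {0..T}) ({0..T} \<inter> x -` N)"
      by (rule continuous_openin_preimage_gen[OF cont assms(2)])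
    moreover have "t \<in> {0..T} \<inter> x -` N" using t assms(5) by auto
    ultimately obtain e where e: "e > 0"
      "\<And>t'. t' \<in> {0..T} \<Longrightarrow> dist t' t < e \<Longrightarrow> t' \<in> {0..T} \<inter> x -` N"
      unfolding openin_euclidean_subtopology_iff by blast
    have "\<exists>c. \<forall>s\<in>{0..T} \<inter> ball t e. x s = c"
    proof (rule has_vector_derivative_zero_constant)
      show "convex ({0..T} \<inter> ball t e)" by (simp add: convex_Int)
      show "(x has_vector_derivative 0) (at s within {0..T} \<inter> ball t e)"
        if "s \<in> {0..T} \<inter> ball t e" for s
      proof -
        have "x s \<in> N" using e(2)[of s] that by (auto simp: dist_commute)
        then have "(x has_vector_derivative 0) (at s within {0..T})"
          using deriv[of s] assms(3) that by auto
        then show ?thesis by (rule has_vector_derivative_within_subset) auto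
      qed
    qed blast
    then have "x t' = x t" if "t' \<in> {0..T}" "dist t' t < e" for t'
      using t e(1) that by (metis IntD1 IntI centre_in_ball dist_commute mem_ball)
    then show "\<exists>e>0. \<forall>t'\<in>{0..T}. dist t' t < e \<longrightarrow> t' \<in> ?E"
      using e(1) t by auto
  qed auto
  moreover have "closedin (top_of_set {0..T}) ?E"
    by (rule continuous_closedin_preimage[OF cont]) auto
  moreover have "?E \<noteq> {}" using assms(4) by auto
  ultimately have "?E = {0..T}"
    using connected_clopen[of "{0..T}"] by auto
  then show ?thesis using assms(6) by blast
qed

section \<open>Transport of admissible Hamiltonians\<close>

text \<open>If \<open>C\<close> exhausted \<open>W\<close>, then \<open>W\<close> would be clopen,
  hence the whole space, which is not compact. The lemma supplies a point at which a Hamiltonian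
  attains its maximum.\<close>

lemma open_diff_compact_nonempty:
  fixes W :: "'a::euclidean_space set"
  assumes "open W" "W \<noteq> {}" "compact C" "C \<subseteq> W"
  shows "W - C \<noteq> {}"
proof
  assume "W - C = {}"
  then have "compact W" using assms by (metis Diff_eq_empty_iff subset_antisym)
  then have "W = UNIV" using assms(1,2) clopen compact_imp_closed by blast
  then show False using \<open>compact W\<close> not_compact_UNIV by simp
qed

lemma ham_max_eqI:
  assumes "z \<in> W" "H z = m" "\<And>x. x \<in> W \<Longrightarrow> H x \<le> m"
  shows "ham_max W H = m"
  unfolding ham_max_def by (rule cSup_eq_maximum) (use assms in auto)

lemma hamiltoniansE:
  assumes "H \<in> hamiltonians \<Psi> W"
  obtains U C where "smooth_on W H" "open U" "U \<subseteq> W" "U \<inter> Fix \<Psi> \<noteq> {}" "\<And>x. x \<in> U \<Longrightarrow> H x = 0"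
    "compact C" "C \<subseteq> W" "\<And>x. x \<in> W - C \<Longrightarrow> H x = ham_max W H"
    "\<And>x. x \<in> W \<Longrightarrow> 0 \<le> H x" "\<And>x. x \<in> W \<Longrightarrow> H x \<le> ham_max W H"
  using assms unfolding hamiltonians_def by blast

lemma hamiltoniansI:
  assumes "smooth_on W H" "open U" "U \<subseteq> W" "U \<inter> Fix \<Psi> \<noteq> {}" "\<And>x. x \<in> U \<Longrightarrow> H x = 0"
    "compact C" "C \<subseteq> W" "\<And>x. x \<in> W - C \<Longrightarrow> H x = ham_max W H"
    "\<And>x. x \<in> W \<Longrightarrow> 0 \<le> H x" "\<And>x. x \<in> W \<Longrightarrow> H x \<le> ham_max W H"
  shows "H \<in> hamiltonians \<Psi> W"
  using assms unfolding hamiltonians_def by blast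

lemma admissibleI:
  assumes "\<And>T x t. 0 < T \<Longrightarrow> T \<le> 1 \<Longrightarrow> (\<And>t. t \<in> {0..T} \<Longrightarrow> x t \<in> W) \<Longrightarrow>
      (\<And>t. t \<in> {0..T} \<Longrightarrow> (x has_vector_derivative ham_vf H (x t)) (at t within {0..T})) \<Longrightarrow>
      x T = \<Psi> (x 0) \<Longrightarrow> t \<in> {0..T} \<Longrightarrow> x t = x 0"
  shows "admissible \<Psi> W H"
  unfolding admissible_def image_subset_iff using assms by blast

lemma admissibleD:
  assumes "admissible \<Psi> W H" "0 < T" "T \<le> 1" "\<And>t. t \<in> {0..T} \<Longrightarrow> x t \<in> W"
    "\<And>t. t \<in> {0..T} \<Longrightarrow> (x has_vector_derivative ham_vf H (x t)) (at t within {0..T})"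
    "x T = \<Psi> (x 0)" "t \<in> {0..T}"
  shows "x t = x 0"
  using assms unfolding admissible_def image_subset_iff by blast

text \<open>The extension \<open>K\<close> of \<open>H\<close> by its maximum is smooth because
  \<open>W'\<close> is covered by the open sets \<open>W\<close>, where \<open>K\<close> is
  \<open>H\<close>, and \<open>W' - C\<close>, where \<open>K\<close> is constant.\<close>

lemma c_HZ_mono:
  fixes \<Psi> :: "'n::finite phase \<Rightarrow> 'n phase"
  assumes "open W" "open W'" "W \<subseteq> W'"
  shows "c_HZ \<Psi> W \<le> c_HZ \<Psi> W'"
  unfolding c_HZ_def
proof (rule SUP_mono)
  fix H assume "H \<in> {H \<in> hamiltonians \<Psi> W. admissible \<Psi> W H}"
  then have ham: "H \<in> hamiltonians \<Psi> W" and adm: "admissible \<Psi> W H" by auto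
  from ham obtain U C where H: "smooth_on W H" "open U" "U \<subseteq> W" "U \<inter> Fix \<Psi> \<noteq> {}"
    "\<And>x. x \<in> U \<Longrightarrow> H x = 0" "compact C" "C \<subseteq> W" "\<And>x. x \<in> W - C \<Longrightarrow> H x = ham_max W H"
    "\<And>x. x \<in> W \<Longrightarrow> 0 \<le> H x" "\<And>x. x \<in> W \<Longrightarrow> H x \<le> ham_max W H"
    by (rule hamiltoniansE) blast
  define m where "m = ham_max W H"
  define K where "K x = (if x \<in> W then H x else m)" for x
  have KH: "K x = H x" if "x \<in> W" for x using that by (simp add: K_def)
  have Km: "K x = m" if "x \<in> W' - C" for x using that H(8) by (auto simp: K_def m_def)
  have oC: "open (W' - C)" using assms(2) H(6) by (simp add: compact_imp_closed open_Diff)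
  have "W \<noteq> {}" using H(3,4) by auto
  then obtain z where z: "z \<in> W - C"
    using open_diff_compact_nonempty[OF assms(1) _ H(6,7)] by blast
  have m0: "0 \<le> m" using H(8)[OF z] H(9)[of z] z by (simp add: m_def)
  have K_bounds: "0 \<le> K x" "K x \<le> m" for x
    using H(9,10) m0 by (auto simp: K_def m_def)
  have max: "ham_max W' K = m"
    using ham_max_eqI[of z W' K m] z assms(3) Km[of z] K_bounds by blast
  have smooth: "smooth_on W' K"
  proof -
    have "higher_differentiable_on W K k" for k
      using higher_differentiable_on_cong[OF assms(1), of H K k] H(1) KH by (simp add: smooth_on_def)
    moreover have "higher_differentiable_on (W' - C) K k" for k
      by (rule higher_differentiable_on_cong[OF oC _ higher_differentiable_on_const[OF oC, of m]])
        (simp add: Km)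
    ultimately have "higher_differentiable_on (W \<union> (W' - C)) K k" for k
      using higher_differentiable_on_Un assms(1) oC by blast
    moreover have "W \<union> (W' - C) = W'" using assms(3) H(7) by blast
    ultimately show ?thesis by (simp add: smooth_on_def)
  qed
  have "K \<in> hamiltonians \<Psi> W'"
  proof (rule hamiltoniansI[OF smooth H(2) _ H(4) _ H(6)])
    show "U \<subseteq> W'" "C \<subseteq> W'" using H(3,7) assms(3) by blast+
    show "K x = 0" if "x \<in> U" for x using that H(3) H(5)[of x] KH[of x] by auto
  qed (simp_all add: max Km K_bounds)
  moreover have "admissible \<Psi> W' K"
  proof (rule admissibleI)
    fix T t :: real and x
    assume T: "0 < T" "T \<le> 1" and xW: "\<And>t. t \<in> {0..T} \<Longrightarrow> x t \<in> W'"
      and x': "\<And>t. t \<in> {0..T} \<Longrightarrow> (x has_vector_derivative ham_vf K (x t)) (at t within {0..T})"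
      and xT: "x T = \<Psi> (x 0)" and t: "t \<in> {0..T}"
    show "x t = x 0"
    \<comment> \<open>A trajectory inside \<open>C\<close> stays in \<open>W\<close> and is a
      trajectory of \<open>H\<close>. One that leaves \<open>C\<close> is at some time in an open
      set where the field vanishes, so it never moves.\<close>
    proof (cases "\<forall>s\<in>{0..T}. x s \<in> C")
      case True
      then have inW: "x s \<in> W" if "s \<in> {0..T}" for s using that H(7) by blast
      moreover have "ham_vf K (x s) = ham_vf H (x s)" if "s \<in> {0..T}" for s
        using ham_vf_cong[OF assms(1) inW[OF that]] KH by blast
      ultimately show ?thesis
        using admissibleD[OF adm T _ _ xT t] x' by force
    next
      case False
      then obtain s where s: "s \<in> {0..T}" "x s \<in> W' - C" using xW by blast
      have "ham_vf K y = 0" if "y \<in> W' - C" for y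
        using ham_vf_cong[OF oC that, of K "\<lambda>_. m"] Km ham_vf_const by metis
      then have "x r = x s" if "r \<in> {0..T}" for r
        using integral_curve_const[OF x' oC _ s that] by blast
      then show ?thesis using t T by force
    qed
  qed
  ultimately show "\<exists>K\<in>{H \<in> hamiltonians \<Psi> W'. admissible \<Psi> W' H}. ereal (ham_max W H) \<le> ereal (ham_max W' K)"
    using max m_def by (intro bexI[of _ K]) auto
qed

text \<open>Since \<open>M\<close> inverts \<open>L\<close>, conformality reads
  \<open>omega0 (L X) w = \<kappa> * omega0 X (M w)\<close>. The chain rule produces the same factor
  and the same \<open>M w\<close> on the side of the derivative.\<close>

lemma ham_vf_conformal:
  fixes L M :: "'n::finite phase \<Rightarrow> 'n phase"
  assumes "bounded_linear M" "\<And>z. M (L z) = z" "\<And>z. L (M z) = z"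
    and "\<And>z w. omega0 (L z) (L w) = \<kappa> * omega0 z w"
    and "H differentiable (at (M y + d))"
  shows "ham_vf (\<lambda>y. \<kappa> * H (M y + d)) y = L (ham_vf H (M y + d))"
proof (rule ham_vf_eqI)
  fix w
  let ?D = "frechet_derivative H (at (M y + d))"
  have "(H has_derivative ?D) (at (M y + d))"
    using assms(5) by (simp add: frechet_derivative_works)
  moreover have "((\<lambda>y. M y + d) has_derivative M) (at y)"
    by (intro has_derivative_add_const bounded_linear_imp_has_derivative assms)
  ultimately have "((\<lambda>y. H (M y + d)) has_derivative (\<lambda>w. ?D (M w))) (at y)"
    using has_derivative_compose[of "\<lambda>y. M y + d" M y UNIV H] by simp
  then have "((\<lambda>y. \<kappa> * H (M y + d)) has_derivative (\<lambda>w. \<kappa> * ?D (M w))) (at y)"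
    by (rule has_derivative_mult_right)
  then have "frechet_derivative (\<lambda>y. \<kappa> * H (M y + d)) (at y) = (\<lambda>w. \<kappa> * ?D (M w))"
    using frechet_derivative_at by metis
  moreover have "omega0 (L (ham_vf H (M y + d))) w = \<kappa> * omega0 (ham_vf H (M y + d)) (M w)"
    using assms(3,4) by metis
  ultimately show "omega0 (L (ham_vf H (M y + d))) w
      = - frechet_derivative (\<lambda>y. \<kappa> * H (M y + d)) (at y) w"
    using omega0_ham_vf[OF assms(5)] by simp
qed

text \<open>Multiplying the Hamiltonian by \<open>\<kappa>\<close> compensates the scaling of
  \<open>omega0\<close>: the affine map takes trajectories to trajectories without changing time, so
  the bound \<open>T \<le> 1\<close> is preserved. The relation \<open>conj\<close> matches the two
  boundary conditions.\<close>

lemma c_HZ_conformal: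
  fixes L M \<Psi> \<Psi>' :: "'n::finite phase \<Rightarrow> 'n phase" and c :: "'n phase"
  assumes "open W" "bounded_linear L" "bounded_linear M" "\<And>z. M (L z) = z" "\<And>z. L (M z) = z"
    and "\<And>z w. omega0 (L z) (L w) = \<kappa> * omega0 z w" "\<kappa> > 0"
    and conj: "\<And>z. \<Psi>' (L z + c) = L (\<Psi> z) + c"
  shows "ereal \<kappa> * c_HZ \<Psi> W \<le> c_HZ \<Psi>' ((\<lambda>z. L z + c) ` W)"
proof -
  define \<Phi> where "\<Phi> z = L z + c" for z
  define d where "d = - M c"
  define P where "P y = M y + d" for y
  interpret L: bounded_linear L by fact
  interpret M: bounded_linear M by fact
  have P\<Phi>: "P (\<Phi> z) = z" and \<Phi>P: "\<Phi> (P y) = y" for z y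
    using assms(4,5) by (simp_all add: P_def \<Phi>_def d_def L.add L.neg L.diff M.add)
  \<comment> \<open>Images become preimages under \<open>P\<close>, for which openness and
    smoothness follow from continuity and composition.\<close>
  have img: "\<Phi> ` S = P -` S" for S
    using P\<Phi> \<Phi>P by (auto simp: image_iff) metis
  have openP: "open (P -` S)" if "open S" for S
    unfolding P_def
    by (rule open_vimage[OF that]) (intro continuous_on_add continuous_on_const linear_continuous_on assms)
  \<comment> \<open>With \<open>\<kappa>\<close> moved to the right, the supremum over
    \<open>H\<close> can be taken directly on the left.\<close>
  have "ereal (ham_max W H) \<le> c_HZ \<Psi>' (\<Phi> ` W) / ereal \<kappa>"
    if ham: "H \<in> hamiltonians \<Psi> W" and adm: "admissible \<Psi> W H" for H
  proof -
    from ham obtain U C where H: "smooth_on W H" "open U" "U \<subseteq> W" "U \<inter> Fix \<Psi> \<noteq> {}"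
      "\<And>x. x \<in> U \<Longrightarrow> H x = 0" "compact C" "C \<subseteq> W" "\<And>x. x \<in> W - C \<Longrightarrow> H x = ham_max W H"
      "\<And>x. x \<in> W \<Longrightarrow> 0 \<le> H x" "\<And>x. x \<in> W \<Longrightarrow> H x \<le> ham_max W H"
      by (rule hamiltoniansE) blast
    define K where "K y = \<kappa> * H (P y)" for y
    have "W \<noteq> {}" using H(3,4) by auto
    then obtain z where z: "z \<in> W - C"
      using open_diff_compact_nonempty[OF assms(1) _ H(6,7)] by blast
    have max: "ham_max (\<Phi> ` W) K = \<kappa> * ham_max W H"
      by (rule ham_max_eqI[of "\<Phi> z"]) (use z H(8,10) assms(7) P\<Phi> in \<open>auto simp: K_def\<close>)
    have "K \<in> hamiltonians \<Psi>' (\<Phi> ` W)"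
    proof (rule hamiltoniansI[where U = "\<Phi> ` U" and C = "\<Phi> ` C"])
      show "smooth_on (\<Phi> ` W) K"
        unfolding img K_def
      proof (intro smooth_on_mult smooth_on_const openP assms(1))
        show "smooth_on (P -` W) (\<lambda>y. H (P y))"
          using higher_differentiable_on_comp_affine[OF assms(1,3)] H(1)
          unfolding smooth_on_def P_def[abs_def] by blast
      qed
      show "open (\<Phi> ` U)" unfolding img by (rule openP) fact
      obtain f where "f \<in> U" "\<Psi> f = f" using H(4) by (auto simp: Fix_def)
      then have "\<Phi> f \<in> \<Phi> ` U \<inter> Fix \<Psi>'" using conj[of f] by (auto simp: Fix_def \<Phi>_def)
      then show "\<Phi> ` U \<inter> Fix \<Psi>' \<noteq> {}" by blast
      show "compact (\<Phi> ` C)"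
        unfolding \<Phi>_def
        by (intro compact_continuous_image continuous_on_add continuous_on_const linear_continuous_on H assms)
      show "K y = ham_max (\<Phi> ` W) K" if "y \<in> \<Phi> ` W - \<Phi> ` C" for y
        using that H(8)[of "P y"] unfolding max unfolding img by (simp add: K_def)
    qed (use H assms(7) P\<Phi> max in \<open>auto simp: K_def\<close>)
    moreover have "admissible \<Psi>' (\<Phi> ` W) K"
    proof (rule admissibleI)
      fix T t :: real and y
      assume T: "0 < T" "T \<le> 1" and yW: "\<And>t. t \<in> {0..T} \<Longrightarrow> y t \<in> \<Phi> ` W"
        and y': "\<And>t. t \<in> {0..T} \<Longrightarrow> (y has_vector_derivative ham_vf K (y t)) (at t within {0..T})"
        and yT: "y T = \<Psi>' (y 0)" and t: "t \<in> {0..T}"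
      have PW: "P (y s) \<in> W" if "s \<in> {0..T}" for s
        using yW[OF that] unfolding img by simp
      have "P (y t) = P (y 0)"
      proof (rule admissibleD[OF adm T PW _ _ t])
        show "((\<lambda>s. P (y s)) has_vector_derivative ham_vf H (P (y s))) (at s within {0..T})"
          if s: "s \<in> {0..T}" for s
        proof -
          have "H differentiable (at (P (y s)))"
            using smooth_on_imp_differentiable[OF H(1) PW[OF s]] .
          then have "ham_vf K (y s) = L (ham_vf H (P (y s)))"
            using ham_vf_conformal[OF assms(3,4,5,6)] unfolding K_def P_def by blast
          then have "(y has_vector_derivative L (ham_vf H (P (y s)))) (at s within {0..T})"
            using y'[OF s] by simp
          from M.has_vector_derivative[OF this] show ?thesis
            unfolding P_def using assms(4) by (simp add: has_vector_derivative_add_const)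
        qed
        have "y 0 = \<Phi> (P (y 0))" using \<Phi>P by simp
        then have "y T = \<Phi> (\<Psi> (P (y 0)))" using yT conj unfolding \<Phi>_def by metis
        then show "P (y T) = \<Psi> (P (y 0))" using P\<Phi> by simp
      qed
      then show "y t = y 0" using \<Phi>P by metis
    qed
    ultimately have "ereal (ham_max (\<Phi> ` W) K) \<le> c_HZ \<Psi>' (\<Phi> ` W)"
      unfolding c_HZ_def by (intro SUP_upper) auto
    then show ?thesis
      using assms(7) by (simp add: ereal_le_divide_pos max)
  qed
  then have "c_HZ \<Psi> W \<le> c_HZ \<Psi>' (\<Phi> ` W) / ereal \<kappa>"
    unfolding c_HZ_def[of \<Psi>] by (intro SUP_least) auto
  then show ?thesis
    using assms(7) by (simp add: ereal_le_divide_pos \<Phi>_def[abs_def])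
qed

section \<open>Rotations and the number t of a block diagonal map\<close>

declare transpose_matrix_vector [simp del]

section \<open>Phase space maps in coordinates and the exponential of J\<close>

lemma matrix_inv_works:
  assumes "invertible A"
  shows "A ** matrix_inv A = mat 1" "matrix_inv A ** A = mat 1"
  using someI_ex[OF assms[unfolded invertible_def]] by (auto simp: matrix_inv_def)

lemma of_to_coords: "of_coords (to_coords z) = z"
  by (simp add: of_coords_def to_coords_def prod_eq_iff vec_eq_iff)

lemma to_of_coords: "to_coords (of_coords x) = x"
  by (simp add: of_coords_def to_coords_def vec_eq_iff split: sum.split)

lemma linear_to_coords: "linear to_coords"
  by (rule linearI) (simp_all add: to_coords_def vec_eq_iff split: sum.split)

lemma linear_of_coords: "linear of_coords"
  by (rule linearI) (simp_all add: of_coords_def prod_eq_iff vec_eq_iff)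

lemma phase_matrix_works:
  assumes "linear F"
  shows "phase_matrix F *v x = to_coords (F (of_coords x))"
proof -
  have "linear (\<lambda>x. to_coords (F (of_coords x)))"
    using linear_compose[OF linear_compose[OF linear_of_coords assms] linear_to_coords]
    by (simp add: o_def)
  then show ?thesis by (simp add: phase_matrix_def)
qed

lemma linear_Psi: "linear (Psi A)"
  by (rule linearI) (auto simp: Psi_def matrix_vector_right_distrib matrix_vector_mult_scaleR)

lemma linear_J: "linear J"
  by (rule linearI) (auto simp: J_def)

text \<open>The powers of \<open>M\<close> alternate, up to sign, between the identity and
  \<open>M\<close>, so the exponential series splits into the cosine and the sine series.\<close>

lemma mat_exp_complex_structure:
  assumes "M ** M = - mat 1"
  shows "mat_exp (s *\<^sub>R M) = cos s *\<^sub>R mat 1 + sin s *\<^sub>R M"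
proof -
  \<comment> \<open>The coefficients vanish for the wrong parity and carry the sign and the inverse
    factorial, so one formula covers even and odd powers.\<close>
  have pow: "mat_power (s *\<^sub>R M) n = (fact n * cos_coeff n * s ^ n) *\<^sub>R mat 1
      + (fact n * sin_coeff n * s ^ n) *\<^sub>R M" for n
  proof (induction n)
    case (Suc n)
    have "mat_power (s *\<^sub>R M) (Suc n)
        = (s * (fact n * cos_coeff n * s ^ n)) *\<^sub>R M
          + (s * (fact n * sin_coeff n * s ^ n)) *\<^sub>R (- mat 1)"
      unfolding assms[symmetric]
      by (simp add: Suc.IH matrix_add_ldistrib matrix_scalar_ac flip: scalar_matrix_assoc)
        (simp add: mult.assoc mult.commute)
    moreover have "s * (fact n * cos_coeff n * s ^ n) = fact (Suc n) * sin_coeff (Suc n) * s ^ Suc n"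
      by (simp add: sin_coeff_Suc)
    moreover have "- (s * (fact n * sin_coeff n * s ^ n)) = fact (Suc n) * cos_coeff (Suc n) * s ^ Suc n"
      by (simp add: cos_coeff_Suc)
    ultimately show ?case by (simp add: scaleR_minus_left[symmetric] del: scaleR_minus_left)
  qed (simp add: cos_coeff_def sin_coeff_def)
  have "(1 / fact n) *\<^sub>R mat_power (s *\<^sub>R M) n
      = (cos_coeff n *\<^sub>R s ^ n) *\<^sub>R mat 1 + (sin_coeff n *\<^sub>R s ^ n) *\<^sub>R M" for n
    by (simp add: pow scaleR_add_right)
  moreover have "(\<lambda>n. (cos_coeff n *\<^sub>R s ^ n) *\<^sub>R mat 1 + (sin_coeff n *\<^sub>R s ^ n) *\<^sub>R M)
      sums (cos s *\<^sub>R mat 1 + sin s *\<^sub>R M)"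
    by (intro sums_add bounded_linear.sums[OF bounded_linear_scaleR_left] cos_converges sin_converges)
  ultimately show ?thesis
    by (simp add: mat_exp_def sums_unique[symmetric])
qed

lemma phase_matrix_J_square:
  "phase_matrix J ** phase_matrix (J :: 'a::finite phase \<Rightarrow> 'a phase) = - mat 1"
proof -
  have "(phase_matrix J ** phase_matrix (J :: 'a phase \<Rightarrow> 'a phase)) *v x = - x" for x
  proof -
    have "J (J z) = - z" for z :: "'a phase" by (simp add: J_def split: prod.split)
    moreover have "to_coords (- z) = - to_coords z" for z :: "'a phase"
      using linear_neg[OF linear_to_coords] .
    ultimately show ?thesis
      by (simp add: matrix_vector_mul_assoc[symmetric] phase_matrix_works[OF linear_J]
          of_to_coords to_of_coords matrix_vector_mult_diff_rdistrib)
  qed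
  moreover have "(- mat 1) *v x = - x" for x :: "real^('a + 'a)"
    using matrix_vector_mult_diff_rdistrib[of 0 "mat 1" x] by simp
  ultimately show ?thesis by (simp add: matrix_eq)
qed

lemma det_eq_0_iff_kernel:
  fixes N :: "real^'m^'m"
  shows "det N = 0 \<longleftrightarrow> (\<exists>x. x \<noteq> 0 \<and> N *v x = 0)"
  using invertible_det_nz[of N] invertible_left_inverse[of N] matrix_left_invertible_ker[of N] by blast

text \<open>A zero determinant means a nonzero kernel vector; \<open>of_coords\<close> carries it
  back to the phase space, where the exponential is the rotation by \<open>s\<close>.\<close>

lemma det_phase_matrix_eq_0_iff:
  assumes "linear F"
  shows "det (phase_matrix F - mat_exp (s *\<^sub>R phase_matrix J)) = 0
    \<longleftrightarrow> (\<exists>z. z \<noteq> 0 \<and> F z = cos s *\<^sub>R z + sin s *\<^sub>R J z)"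
proof -
  have E: "(phase_matrix F - mat_exp (s *\<^sub>R phase_matrix J)) *v to_coords z
      = to_coords (F z - (cos s *\<^sub>R z + sin s *\<^sub>R J z))" for z
    using phase_matrix_works[OF assms, of "to_coords z"] phase_matrix_works[OF linear_J, of "to_coords z"]
    by (simp add: mat_exp_complex_structure[OF phase_matrix_J_square] of_to_coords
        linear_diff[OF linear_to_coords] linear_add[OF linear_to_coords] linear_scale[OF linear_to_coords]
        matrix_vector_mult_diff_rdistrib matrix_vector_mult_add_rdistrib scaleR_matrix_vector_assoc[symmetric])
  have z: "to_coords z = 0 \<longleftrightarrow> z = 0" for z :: "'a phase"
    by (metis linear_0[OF linear_to_coords] of_to_coords)
  let ?N = "phase_matrix F - mat_exp (s *\<^sub>R phase_matrix J)"
  have "(\<exists>x. x \<noteq> 0 \<and> ?N *v x = 0) \<longleftrightarrow> (\<exists>z. to_coords z \<noteq> 0 \<and> ?N *v to_coords z = 0)"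
    using to_of_coords by metis
  also have "\<dots> \<longleftrightarrow> (\<exists>z. z \<noteq> 0 \<and> F z = cos s *\<^sub>R z + sin s *\<^sub>R J z)"
    unfolding E z by simp
  finally show ?thesis unfolding det_eq_0_iff_kernel .
qed

section \<open>The generalized eigenvalue problem behind \<open>tt\<close>\<close>

lemma nonneg_quadratic_imp_linear_term_0:
  fixes a b :: real
  assumes "\<And>t. 0 \<le> 2 * t * a + t\<^sup>2 * b"
  shows "a = 0"
proof (rule ccontr)
  assume "a \<noteq> 0"
  \<comment> \<open>At \<open>t = - a / k\<close> the expression is
    \<open>a^2 * (b - 2 * k) / k^2\<close>, negative since \<open>k\<close> exceeds
    \<open>b / 2\<close>.\<close>
  define k where "k = \<bar>b\<bar> + 1"
  have "k > 0" by (simp add: k_def)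
  have "0 \<le> k\<^sup>2 * (2 * (- a / k) * a + (- a / k)\<^sup>2 * b)"
    using assms[of "- a / k"] by simp
  also have "\<dots> = a\<^sup>2 * (b - 2 * k)"
    using \<open>k > 0\<close> by (simp add: field_simps power2_eq_square)
  also have "\<dots> < 0"
    using \<open>a \<noteq> 0\<close> by (intro mult_pos_neg) (auto simp: k_def)
  finally show False by simp
qed

text \<open>Eliminating the momentum from \<open>Psi A (q, v) = e\<^bsup>sJ\<^esup> (q, v)\<close> gives the symmetric
  generalized eigenvalue problem below, with \<open>c = cos s\<close>.\<close>
definition gen_eigenvalue :: "real^'n^'n \<Rightarrow> real \<Rightarrow> bool" where
  "gen_eigenvalue A c \<longleftrightarrow> (\<exists>q. q \<noteq> 0 \<and>
     A *v q + transpose A *v q = c *\<^sub>R (q + transpose A *v (A *v q)))"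

lemma inner_transpose_mult: "(transpose A *v x) \<bullet> y = x \<bullet> (A *v y)" for A :: "real^'n^'m"
  by (metis dot_lmul_matrix transpose_matrix_vector)

text \<open>The pairs \<open>(q, A q)\<close> of eigenvectors \<open>q\<close> for distinct eigenvalues are orthogonal.\<close>
lemma finite_gen_eigenvalues: "finite {c. gen_eigenvalue A c}"
proof -
  have "\<exists>q. \<forall>c. gen_eigenvalue A c \<longrightarrow> q c \<noteq> 0 \<and>
     A *v q c + transpose A *v q c = c *\<^sub>R (q c + transpose A *v (A *v q c))"
    unfolding gen_eigenvalue_def by (intro choice) blast
  then obtain q where q: "\<And>c. gen_eigenvalue A c \<Longrightarrow> q c \<noteq> 0"
    "\<And>c. gen_eigenvalue A c \<Longrightarrow>
       A *v q c + transpose A *v q c = c *\<^sub>R (q c + transpose A *v (A *v q c))"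
    by blast
  define w where "w c = (q c, A *v q c)" for c
  have orth: "w c \<bullet> w d = 0" if "gen_eigenvalue A c" "gen_eigenvalue A d" "c \<noteq> d" for c d
  proof -
    \<comment> \<open>Both sides of the eigenvalue equation are tested against another eigenvector.
      \<open>B\<close> handles the right side and \<open>S\<close> expresses the symmetry of
      \<open>A + transpose A\<close>, as for eigenvectors of a symmetric matrix.\<close>
    have B: "(q c + transpose A *v (A *v q c)) \<bullet> q d = w c \<bullet> w d" for c d
      by (simp add: w_def inner_add_left inner_transpose_mult)
    have S: "(A *v q c + transpose A *v q c) \<bullet> q d = (A *v q d + transpose A *v q d) \<bullet> q c"
      by (simp add: inner_add_left inner_transpose_mult)
        (simp add: inner_commute add.commute)
    have "c * (w c \<bullet> w d) = d * (w d \<bullet> w c)"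
      using S unfolding q(2)[OF that(1)] q(2)[OF that(2)] by (simp add: B)
    then show ?thesis using that(3) by (simp add: inner_commute)
  qed
  have nz: "w c \<noteq> 0" if "gen_eigenvalue A c" for c
    using q(1)[OF that] by (simp add: w_def prod_eq_iff)
  have "inj_on w {c. gen_eigenvalue A c}"
    using orth nz by (intro inj_onI) (metis inner_eq_zero_iff mem_Collect_eq)
  moreover have "finite (w ` {c. gen_eigenvalue A c})"
    by (rule pairwise_orthogonal_imp_finite) (auto simp: pairwise_def orthogonal_def intro!: orth)
  ultimately show ?thesis using finite_imageD by blast
qed

text \<open>The Rayleigh quotient attains its maximum at a generalized eigenvector.\<close>
lemma gen_eigenvalue_exists: "\<exists>c. \<bar>c\<bar> \<le> 1 \<and> gen_eigenvalue A c"
proof -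
  define B where "B q = q \<bullet> q + (A *v q) \<bullet> (A *v q)" for q
  define R where "R q = 2 * ((A *v q) \<bullet> q) / B q" for q
  have Bpos: "B q > 0" if "q \<noteq> 0" for q
    using that by (simp add: B_def add_pos_nonneg)
  have "continuous_on (sphere 0 1) R"
    unfolding R_def B_def
  proof (intro continuous_intros ballI)
    fix q :: "real^'a" assume "q \<in> sphere 0 1"
    then have "q \<noteq> 0" by auto
    from Bpos[OF this] show "q \<bullet> q + (A *v q) \<bullet> (A *v q) \<noteq> 0" by (simp add: B_def)
  qed
  moreover have "sphere 0 1 \<noteq> ({} :: (real^'a) set)" by simp
  ultimately obtain u where u: "u \<in> sphere 0 1" "\<And>q. q \<in> sphere 0 1 \<Longrightarrow> R q \<le> R u"
    using continuous_attains_sup[OF compact_sphere] by blast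
  define c where "c = R u"
  have u0: "u \<noteq> 0" using u(1) by auto
  have max: "R q \<le> c" if "q \<noteq> 0" for q
  proof -
    have "R q = R (inverse (norm q) *\<^sub>R q)"
      using that unfolding R_def B_def
      by (simp add: matrix_vector_mult_scaleR distrib_left[symmetric] mult.assoc[symmetric])
    moreover have "inverse (norm q) *\<^sub>R q \<in> sphere 0 1" using that by simp
    ultimately show ?thesis using u(2) unfolding c_def by metis
  qed
  \<comment> \<open>This symmetric form is nonnegative on the diagonal because \<open>c\<close> is
    the maximum of \<open>R\<close>, and \<open>S u u = 0\<close>. Hence \<open>S u\<close> vanishes
    identically, which is the eigenvalue equation for \<open>u\<close>.\<close>
  define S where "S x y = c * (x \<bullet> y + (A *v x) \<bullet> (A *v y)) - (A *v x) \<bullet> y - (A *v y) \<bullet> x" for x y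
  have nonneg: "0 \<le> S q q" for q
  proof (cases "q = 0")
    case False
    then show ?thesis
      using max[OF False] Bpos[OF False] by (simp add: R_def S_def B_def field_simps)
  qed (simp add: S_def)
  have S0: "S u u = 0"
    using Bpos[OF u0] by (simp add: S_def c_def R_def) (simp add: B_def)
  have "S u y = 0" for y
  proof (rule nonneg_quadratic_imp_linear_term_0)
    fix t
    have "S (u + t *\<^sub>R y) (u + t *\<^sub>R y) = S u u + 2 * t * S u y + t\<^sup>2 * S y y"
      by (simp add: S_def matrix_vector_right_distrib matrix_vector_mult_scaleR inner_add_left
          inner_add_right inner_commute algebra_simps power2_eq_square)
    then show "0 \<le> 2 * t * S u y + t\<^sup>2 * S y y" using nonneg[of "u + t *\<^sub>R y"] S0 by simp
  qed
  moreover have "S u y = (c *\<^sub>R (u + transpose A *v (A *v u)) - (A *v u + transpose A *v u)) \<bullet> y" for y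
    by (simp add: S_def inner_add_left inner_diff_left inner_transpose_mult)
      (simp add: inner_commute algebra_simps)
  ultimately have "c *\<^sub>R (u + transpose A *v (A *v u)) - (A *v u + transpose A *v u) = 0"
    using inner_eq_zero_iff by metis
  then have "gen_eigenvalue A c" using u0 by (auto simp: gen_eigenvalue_def)
  moreover have "\<bar>c\<bar> \<le> 1"
  proof -
    \<comment> \<open>These two squares bound the Rayleigh quotient by 1 in absolute value, which
      makes \<open>c\<close> a cosine.\<close>
    have "0 \<le> (A *v u - u) \<bullet> (A *v u - u)" "0 \<le> (A *v u + u) \<bullet> (A *v u + u)"
      by simp_all
    then have "\<bar>2 * ((A *v u) \<bullet> u)\<bar> \<le> B u"
      by (simp add: B_def inner_add_left inner_add_right inner_diff_left inner_diff_right inner_commute)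
    then show ?thesis using Bpos[OF u0] by (simp add: c_def R_def abs_divide divide_le_eq)
  qed
  ultimately show ?thesis by blast
qed

text \<open>This serves the degenerate case \<open>sin s = 0\<close>, where \<open>c\<close> is 1 or
  -1 and the momentum cannot be eliminated.\<close>

lemma gen_eigenvalue_of_unit_eigenvector:
  assumes "A *v q = c *\<^sub>R q" "c\<^sup>2 = 1" "q \<noteq> 0"
  shows "gen_eigenvalue A c"
  unfolding gen_eigenvalue_def
  using assms
  by (intro exI[of _ q]) (simp add: matrix_vector_mult_scaleR scaleR_add_right power2_eq_square)

text \<open>For \<open>sin s \<noteq> 0\<close> the position equation determines \<open>v\<close>,
  and inserting it into the momentum equation leaves the eigenvalue problem for \<open>q\<close>.
  For \<open>sin s = 0\<close> the two equations decouple and each is an ordinary eigenvalue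
  equation.\<close>

lemma Psi_rotation_eigenvector_iff:
  fixes A :: "real^'n^'n"
  assumes "invertible A"
  shows "(\<exists>z. z \<noteq> 0 \<and> Psi A z = cos s *\<^sub>R z + sin s *\<^sub>R J z) \<longleftrightarrow> gen_eigenvalue A (cos s)"
proof -
  define c d where "c = cos s" and "d = sin s"
  have cd: "c\<^sup>2 + d\<^sup>2 = 1" by (simp add: c_def d_def)
  have invT: "invertible (transpose A)" using assms by (rule transpose_invertible)
  have inv: "matrix_inv (transpose A) *v v = w \<longleftrightarrow> v = transpose A *v w" for v w
  proof -
    have "matrix_inv (transpose A) ** transpose A = mat 1" "transpose A ** matrix_inv (transpose A) = mat 1"
      using matrix_inv_works[OF invT] by auto
    then show ?thesis by (metis matrix_vector_mul_assoc matrix_vector_mul_lid)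
  qed
  have eq: "Psi A (q, v) = c *\<^sub>R (q, v) + d *\<^sub>R J (q, v)
    \<longleftrightarrow> A *v q = c *\<^sub>R q - d *\<^sub>R v \<and> v = transpose A *v (c *\<^sub>R v + d *\<^sub>R q)" for q v
    by (simp add: Psi_def J_def inv)
  \<comment> \<open>By \<open>c^2 + d^2 = 1\<close>, the vector under \<open>transpose A\<close> in
    the momentum equation becomes free of \<open>v\<close> after multiplication by
    \<open>d\<close>.\<close>
  have elim: "d *\<^sub>R (d *\<^sub>R q + c *\<^sub>R v) = q - c *\<^sub>R (A *v q)" if "A *v q = c *\<^sub>R q - d *\<^sub>R v" for q v
  proof -
    have "q - c *\<^sub>R (A *v q) = (1 - c\<^sup>2) *\<^sub>R q + (c * d) *\<^sub>R v"
      by (simp add: that algebra_simps power2_eq_square)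
    also have "1 - c\<^sup>2 = d\<^sup>2" using cd by simp
    finally show ?thesis by (simp add: algebra_simps power2_eq_square)
  qed
  show ?thesis
    unfolding c_def[symmetric] d_def[symmetric]
  proof
    assume "\<exists>z. z \<noteq> 0 \<and> Psi A z = c *\<^sub>R z + d *\<^sub>R J z"
    then obtain q v where nz: "(q, v) \<noteq> 0" and q: "A *v q = c *\<^sub>R q - d *\<^sub>R v"
      and v: "v = transpose A *v (c *\<^sub>R v + d *\<^sub>R q)"
      using eq by (metis surj_pair)
    show "gen_eigenvalue A c"
    proof (cases "d = 0")
      case False
      have "q \<noteq> 0"
        using nz q False by (auto simp: zero_prod_def)
      have "d *\<^sub>R v = transpose A *v (d *\<^sub>R (c *\<^sub>R v + d *\<^sub>R q))"
        by (subst v) (simp add: matrix_vector_mult_scaleR)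
      also have "\<dots> = transpose A *v (q - c *\<^sub>R (A *v q))"
        using elim[OF q] by (simp add: add.commute)
      also have "\<dots> = transpose A *v q - c *\<^sub>R (transpose A *v (A *v q))"
        by (simp only: matrix_vector_mult_diff_distrib matrix_vector_mult_scaleR)
      finally have "c *\<^sub>R q - A *v q = transpose A *v q - c *\<^sub>R (transpose A *v (A *v q))"
        using q by (metis add_diff_cancel_left' diff_add_cancel)
      then have "A *v q + transpose A *v q = c *\<^sub>R (q + transpose A *v (A *v q))"
        by (simp add: scaleR_add_right algebra_simps)
      then show ?thesis using \<open>q \<noteq> 0\<close> by (auto simp: gen_eigenvalue_def)
    next
      case True
      then have c2: "c\<^sup>2 = 1" using cd by simp
      show ?thesis
      proof (cases "q = 0")
        case False
        then show ?thesis
          using gen_eigenvalue_of_unit_eigenvector[OF _ c2 False] q True by simp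
      next
        \<comment> \<open>Here only \<open>v\<close> is nonzero, an eigenvector of
          \<open>transpose A\<close>. Equality of the determinants yields an eigenvector of
          \<open>A\<close> for the same \<open>c\<close>.\<close>
        case q0: True
        then have "v \<noteq> 0" using nz by (auto simp: zero_prod_def)
        have "v = c *\<^sub>R (transpose A *v v)"
          using v True by (simp add: matrix_vector_mult_scaleR)
        then have "c *\<^sub>R v = (c * c) *\<^sub>R (transpose A *v v)" by (metis scaleR_scaleR)
        then have "transpose A *v v = c *\<^sub>R v" using c2 by (simp add: power2_eq_square)
        moreover have "transpose (A - c *\<^sub>R mat 1) = transpose A - c *\<^sub>R mat 1"
          by (simp add: transpose_def vec_eq_iff mat_def)
        ultimately have "transpose (A - c *\<^sub>R mat 1) *v v = 0"
          by (simp add: matrix_vector_mult_diff_rdistrib scaleR_matrix_vector_assoc[symmetric])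
        then have "det (transpose (A - c *\<^sub>R mat 1)) = 0"
          using \<open>v \<noteq> 0\<close> det_eq_0_iff_kernel by blast
        then have "det (A - c *\<^sub>R mat 1) = 0" by (simp only: det_transpose)
        then obtain p where "p \<noteq> 0" "(A - c *\<^sub>R mat 1) *v p = 0"
          using det_eq_0_iff_kernel by blast
        then show ?thesis
          using gen_eigenvalue_of_unit_eigenvector[OF _ c2, of A p]
          by (simp add: matrix_vector_mult_diff_rdistrib scaleR_matrix_vector_assoc[symmetric])
      qed
    qed
  next
    assume "gen_eigenvalue A c"
    then obtain q where q0: "q \<noteq> 0"
      and q: "A *v q + transpose A *v q = c *\<^sub>R (q + transpose A *v (A *v q))"
      by (auto simp: gen_eigenvalue_def)
    have "\<exists>v. A *v q = c *\<^sub>R q - d *\<^sub>R v \<and> v = transpose A *v (c *\<^sub>R v + d *\<^sub>R q)"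
    proof (cases "d = 0")
      case False
      define v where "v = inverse d *\<^sub>R (c *\<^sub>R q - A *v q)"
      have Aq: "A *v q = c *\<^sub>R q - d *\<^sub>R v" using False by (simp add: v_def)
      have "d *\<^sub>R v = c *\<^sub>R q - A *v q" using False by (simp add: v_def)
      also have "\<dots> = transpose A *v (q - c *\<^sub>R (A *v q))"
        using q by (simp add: matrix_vector_mult_diff_distrib matrix_vector_mult_scaleR algebra_simps)
      also have "\<dots> = d *\<^sub>R (transpose A *v (c *\<^sub>R v + d *\<^sub>R q))"
        using elim[OF Aq] by (simp add: add.commute flip: matrix_vector_mult_scaleR)
      finally have "v = transpose A *v (c *\<^sub>R v + d *\<^sub>R q)" using False by simp
      then show ?thesis using Aq by blast
    next
      case True
      then have c2: "c\<^sup>2 = 1" using cd by simp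
      \<comment> \<open>Testing the equation against \<open>q\<close> and using
        \<open>c^2 = 1\<close> gives norm 0 for \<open>A *v q - c *\<^sub>R q\<close>. So
        \<open>q\<close> is an eigenvector of \<open>A\<close>, and \<open>v = 0\<close> completes
        the pair.\<close>
      have "(A *v q + transpose A *v q) \<bullet> q = c * (q \<bullet> q + (A *v q) \<bullet> (A *v q))"
        by (simp add: q inner_add_left inner_transpose_mult)
      then have "2 * ((A *v q) \<bullet> q) = c * (q \<bullet> q + (A *v q) \<bullet> (A *v q))"
        by (simp add: inner_add_left inner_transpose_mult inner_commute[of q "A *v q"])
      then have "c * (2 * ((A *v q) \<bullet> q)) = c\<^sup>2 * (q \<bullet> q + (A *v q) \<bullet> (A *v q))"
        by (simp add: power2_eq_square)
      moreover have "(A *v q - c *\<^sub>R q) \<bullet> (A *v q - c *\<^sub>R q)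
          = (A *v q) \<bullet> (A *v q) + c\<^sup>2 * (q \<bullet> q) - c * (2 * ((A *v q) \<bullet> q))"
        by (simp add: inner_diff_left inner_diff_right inner_commute[of q "A *v q"]
            power2_eq_square algebra_simps)
      ultimately have "(A *v q - c *\<^sub>R q) \<bullet> (A *v q - c *\<^sub>R q) = 0" using c2 by simp
      then have "A *v q = c *\<^sub>R q" by simp
      then show ?thesis using True by (intro exI[of _ 0]) simp
    qed
    then obtain v where "Psi A (q, v) = c *\<^sub>R (q, v) + d *\<^sub>R J (q, v)" using eq by blast
    then show "\<exists>z. z \<noteq> 0 \<and> Psi A z = c *\<^sub>R z + d *\<^sub>R J z"
      using q0 by (intro exI[of _ "(q, v)"]) (simp add: zero_prod_def)
  qed
qed

text \<open>\<open>LEAST\<close> over the reals says something only if a least element exists, so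
  the set \<open>S\<close> of candidates is shown to be finite and nonempty. It is finite since
  there are finitely many eigenvalues and each is the cosine of at most two angles in
  \<open>(0, 2 * pi]\<close>.\<close>

lemma
  assumes "invertible A"
  shows tt_Psi_pos: "0 < tt (Psi A)"
    and no_rotation_eigenvector_below_tt:
      "0 < s \<Longrightarrow> s < tt (Psi A) \<Longrightarrow> Psi A z = cos s *\<^sub>R z + sin s *\<^sub>R J z \<Longrightarrow> z = 0"
proof -
  define E where "E = {c. gen_eigenvalue A c}"
  define S where "S = {s \<in> {0<..2 * pi}. cos s \<in> E}"
  have S_iff: "s \<in> S \<longleftrightarrow> s \<in> {0<..2 * pi} \<and>
      det (phase_matrix (Psi A) - mat_exp (s *\<^sub>R phase_matrix J)) = 0" for s
    unfolding det_phase_matrix_eq_0_iff[OF linear_Psi] Psi_rotation_eigenvector_iff[OF assms]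
    by (simp add: S_def E_def)
  have "S \<subseteq> arccos ` E \<union> (\<lambda>c. 2 * pi - arccos c) ` E"
  proof
    fix s assume s: "s \<in> S"
    show "s \<in> arccos ` E \<union> (\<lambda>c. 2 * pi - arccos c) ` E"
    proof (cases "s \<le> pi")
      case True
      then have "s = arccos (cos s)" using s by (simp add: S_def arccos_cos)
      then show ?thesis using s by (auto simp: S_def)
    next
      case False
      have "arccos (cos (2 * pi - s)) = 2 * pi - s"
        using False s by (intro arccos_cos) (auto simp: S_def)
      then have "s = 2 * pi - arccos (cos s)" by simp
      then show ?thesis using s by (auto simp: S_def)
    qed
  qed
  then have fin: "finite S"
    by (rule finite_subset) (simp add: E_def finite_gen_eigenvalues)
  obtain c where c: "\<bar>c\<bar> \<le> 1" "c \<in> E"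
    using gen_eigenvalue_exists[of A] by (auto simp: E_def)
  \<comment> \<open>The angle \<open>arccos c\<close> itself would be 0 for \<open>c = 1\<close>,
    outside the half-open interval; its reflection lies in \<open>[pi, 2 * pi]\<close>.\<close>
  have "2 * pi - arccos c \<in> S"
    using c arccos_lbound[of c] arccos_ubound[of c] pi_gt_zero
    unfolding S_def by (auto simp: abs_le_iff simp del: pi_gt_zero)
  then have ne: "S \<noteq> {}" by blast
  have tt: "tt (Psi A) = Min S"
    unfolding tt_def S_iff[symmetric]
    by (rule Least_equality) (use fin ne in auto)
  then have "tt (Psi A) \<in> S" using fin ne Min_in by metis
  then have le: "tt (Psi A) \<le> 2 * pi" and pos: "0 < tt (Psi A)" by (auto simp: S_def)
  show "0 < tt (Psi A)" by (rule pos)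
  show "z = 0" if "0 < s" "s < tt (Psi A)" "Psi A z = cos s *\<^sub>R z + sin s *\<^sub>R J z"
  proof (rule ccontr)
    assume "z \<noteq> 0"
    then have "gen_eigenvalue A (cos s)"
      using that(3) Psi_rotation_eigenvector_iff[OF assms, of s] by blast
    then have "s \<in> S" using that(1,2) le by (simp add: S_def E_def)
    then show False using tt that(2) Min_le[OF fin, of s] by simp
  qed
qed

section \<open>The product of two balls and the cylinder\<close>

lemma J_J: "J (J z) = - z"
  by (simp add: J_def split: prod.split)

lemma inner_J_self: "J z \<bullet> z = 0"
  by (simp add: J_def inner_prod_def inner_commute split: prod.split)

lemma omega0_J: "omega0 (J z) w = - (z \<bullet> w)"
  by (simp add: omega0_def J_def inner_prod_def split: prod.split)

lemma ham_vf_comp_inner_self: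
  assumes "\<And>t. (f has_real_derivative f' t) (at t)"
  shows "ham_vf (\<lambda>z. f (z \<bullet> z)) z = (2 * f' (z \<bullet> z)) *\<^sub>R J z"
proof (rule ham_vf_eqI)
  fix w
  have "((\<lambda>z. z \<bullet> z) has_derivative (\<lambda>v. 2 * (z \<bullet> v))) (at z)"
    by (auto intro!: derivative_eq_intros simp: inner_commute)
  from has_derivative_compose[OF this assms[unfolded has_field_derivative_def]]
  have "((\<lambda>z. f (z \<bullet> z)) has_derivative (\<lambda>v. f' (z \<bullet> z) * (2 * (z \<bullet> v)))) (at z)" .
  from frechet_derivative_at[OF this, symmetric]
  have "frechet_derivative (\<lambda>z. f (z \<bullet> z)) (at z) = (\<lambda>v. f' (z \<bullet> z) * (2 * (z \<bullet> v)))" .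
  then show "omega0 ((2 * f' (z \<bullet> z)) *\<^sub>R J z) w = - frechet_derivative (\<lambda>z. f (z \<bullet> z)) (at z) w"
    by (simp add: bounded_bilinear.scaleR_left[OF bounded_bilinear_omega0] omega0_J)
qed

text \<open>Rotating the curve back by the angle \<open>l * s\<close> gives a curve \<open>y\<close>
  with zero derivative; rotating \<open>y t = x 0\<close> forward again recovers
  \<open>x t\<close>.\<close>

lemma rotation_flow_unique:
  fixes x :: "real \<Rightarrow> 'n::finite phase"
  assumes "\<And>t. t \<in> {0..T} \<Longrightarrow> (x has_vector_derivative l *\<^sub>R J (x t)) (at t within {0..T})"
    and t: "t \<in> {0..T}"
  shows "x t = cos (l * t) *\<^sub>R x 0 + sin (l * t) *\<^sub>R J (x 0)"
proof -
  define y where "y s = cos (l * s) *\<^sub>R x s - sin (l * s) *\<^sub>R J (x s)" for s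
  have J: "J (a *\<^sub>R z) = a *\<^sub>R J z" "J (z - w) = J z - J w" for a and z w :: "'n phase"
    by (fact linear_scale[OF linear_J] linear_diff[OF linear_J])+
  have "\<exists>c. \<forall>s\<in>{0..T}. y s = c"
  proof (rule has_vector_derivative_zero_constant)
    show "convex {0..T}" by simp
  next
    fix s assume s: "s \<in> {0..T}"
    have c: "((\<lambda>s. cos (l * s)) has_real_derivative - (l * sin (l * s))) (at s within {0..T})"
      "((\<lambda>s. sin (l * s)) has_real_derivative l * cos (l * s)) (at s within {0..T})"
      by (auto intro!: derivative_eq_intros)
    have Jx: "((\<lambda>s. J (x s)) has_vector_derivative J (l *\<^sub>R J (x s))) (at s within {0..T})"
      using bounded_linear.has_vector_derivative[OF _ assms(1)[OF s]] linear_J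
      by (simp add: linear_conv_bounded_linear)
    show "(y has_vector_derivative 0) (at s within {0..T})"
      unfolding y_def
      by (rule has_vector_derivative_eq_rhs[OF has_vector_derivative_diff[OF
            has_vector_derivative_scaleR[OF c(1) assms(1)[OF s]] has_vector_derivative_scaleR[OF c(2) Jx]]])
        (simp add: J J_J mult.commute)
  qed blast
  then have "y t = y 0" using t by force
  then have yt: "y t = x 0" by (simp add: y_def)
  have "a *\<^sub>R (a *\<^sub>R z - b *\<^sub>R J z) + b *\<^sub>R J (a *\<^sub>R z - b *\<^sub>R J z) = (a\<^sup>2 + b\<^sup>2) *\<^sub>R z"
    for a b and z :: "'n phase"
    unfolding J J_J by (simp add: algebra_simps power2_eq_square)
  from this[of "cos (l * t)" "x t" "sin (l * t)"]
  have "cos (l * t) *\<^sub>R y t + sin (l * t) *\<^sub>R J (y t) = x t"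
    by (simp add: y_def)
  then show ?thesis by (simp add: yt)
qed

text \<open>\<open>J z\<close> is orthogonal to \<open>z\<close>, so the norm is preserved even if
  the speed \<open>l t\<close> varies. For a radial Hamiltonian the speed depends only on the norm,
  so it is then constant along each trajectory.\<close>

lemma inner_self_constant_of_rotation:
  fixes x :: "real \<Rightarrow> 'n::finite phase"
  assumes "\<And>t. t \<in> {0..T} \<Longrightarrow> (x has_vector_derivative l t *\<^sub>R J (x t)) (at t within {0..T})"
    and "t \<in> {0..T}"
  shows "x t \<bullet> x t = x 0 \<bullet> x 0"
proof -
  have "\<exists>c. \<forall>s\<in>{0..T}. x s \<bullet> x s = c"
  proof (rule has_vector_derivative_zero_constant)
    show "convex {0..T}" by simp
  next
    fix s assume "s \<in> {0..T}"
    from assms(1)[OF this]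
    have "((\<lambda>s. x s \<bullet> x s) has_derivative
        (\<lambda>h. x s \<bullet> (h *\<^sub>R (l s *\<^sub>R J (x s))) + (h *\<^sub>R (l s *\<^sub>R J (x s))) \<bullet> x s)) (at s within {0..T})"
      unfolding has_vector_derivative_def by (intro has_derivative_inner)
    then show "((\<lambda>s. x s \<bullet> x s) has_vector_derivative 0) (at s within {0..T})"
      by (simp add: has_vector_derivative_def inner_commute[of _ "J _"] inner_J_self)
  qed blast
  then show ?thesis using assms(2) by force
qed

lemma c_HZ_ball_times_ball_ge_approx:
  fixes A :: "real^'n^'n"
  assumes "invertible A" "0 < e" "4 * e < 1"
  shows "ereal (tt (Psi A) / 2 * (1 - e) * (1 - 4 * e)) \<le> c_HZ (Psi A) (ball 0 1 \<times> ball 0 1)"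
proof -
  \<comment> \<open>The factor \<open>1 - e\<close> keeps the largest angular speed
    \<open>2 * a\<close> strictly below \<open>tt (Psi A)\<close>.\<close>
  define a where "a = tt (Psi A) / 2 * (1 - e)"
  have tt: "0 < tt (Psi A)" by (rule tt_Psi_pos) fact
  have a: "0 \<le> a" "2 * a < tt (Psi A)"
    using tt assms(2,3) by (auto simp: a_def algebra_simps)
  obtain f f' :: "real \<Rightarrow> real" where f: "smooth_on UNIV f"
    "\<And>x. (f has_real_derivative f' x) (at x)" "\<And>x. 0 \<le> f' x" "\<And>x. f' x \<le> a"
    "\<And>x. x \<le> e \<Longrightarrow> f x = 0" "\<And>x. 1 - e \<le> x \<Longrightarrow> f x = f 1" "a * (1 - 4 * e) \<le> f 1"
    using smooth_ramp_exists[OF a(1) assms(2,3)] by blast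
  define W :: "'n phase set" where "W = ball 0 1 \<times> ball 0 1"
  define H :: "'n phase \<Rightarrow> real" where "H z = f (z \<bullet> z)" for z
  \<comment> \<open>A round ball of the whole phase space that fits into the product of balls;
    outside it \<open>f\<close> has reached its final value.\<close>
  define C :: "'n phase set" where "C = cball 0 (sqrt (1 - e))"
  have C: "z \<in> C \<longleftrightarrow> z \<bullet> z \<le> 1 - e" for z
    by (simp add: C_def norm_eq_sqrt_inner)
  have oW: "open W" unfolding W_def by (intro open_Times open_ball)
  have inW: "z \<in> W" if "z \<bullet> z < 1" for z
  proof -
    have "fst z \<bullet> fst z < 1" "snd z \<bullet> snd z < 1"
      using that inner_ge_zero[of "fst z"] inner_ge_zero[of "snd z"]
      by (auto simp: inner_prod_def simp del: inner_ge_zero)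
    then show ?thesis
      by (cases z) (simp add: W_def norm_eq_sqrt_inner)
  qed
  have CW: "C \<subseteq> W" using C inW assms(2) by fastforce
  have "W \<noteq> {}" by (auto simp: W_def)
  moreover have "compact C" by (simp add: C_def)
  ultimately obtain z where z: "z \<in> W - C"
    using open_diff_compact_nonempty[OF oW _ _ CW] by blast
  have mono: "f s \<le> f t" if "s \<le> t" for s t
    by (rule DERIV_nonneg_imp_nondecreasing[OF that]) (use f(2,3) in blast)
  have f0: "0 \<le> f t" for t
    using mono[of e t] f(5)[of e] f(5)[of t] by (cases "t \<le> e") auto
  have f1: "f t \<le> f 1" for t
  proof (cases "t \<le> 1")
    case False
    then have "f t = f 1" using assms(2) by (intro f(6)) simp
    then show ?thesis by simp
  qed (rule mono)
  have max: "ham_max W H = f 1"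
  proof (rule ham_max_eqI)
    show "z \<in> W" using z by simp
    show "H z = f 1" unfolding H_def using z C by (intro f(6)) auto
    show "H x \<le> f 1" for x by (simp add: H_def f1)
  qed
  have "H \<in> hamiltonians (Psi A) W"
  proof (rule hamiltoniansI)
    show "smooth_on W H"
      using f(1) higher_differentiable_on_comp_inner_self[OF oW] unfolding smooth_on_def H_def by blast
    show "open {z :: 'n phase. z \<bullet> z < e}" by (intro open_Collect_less continuous_intros)
    show "{z. z \<bullet> z < e} \<subseteq> W" using inW assms(2,3) by auto
    have "0 \<in> {z. z \<bullet> z < e} \<inter> Fix (Psi A)"
      using assms(2) linear_0[OF linear_Psi] by (simp add: Fix_def)
    then show "{z. z \<bullet> z < e} \<inter> Fix (Psi A) \<noteq> {}" by blast
    show "H x = 0" if "x \<in> {z. z \<bullet> z < e}" for x using that f(5) by (simp add: H_def)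
    show "compact C" by (simp add: C_def)
    show "H x = ham_max W H" if "x \<in> W - C" for x
      unfolding max H_def using that C by (intro f(6)) auto
    show "0 \<le> H x" "H x \<le> ham_max W H" for x unfolding max by (auto simp: H_def f0 f1)
  qed fact
  moreover have "admissible (Psi A) W H"
  proof (rule admissibleI)
    fix T t :: real and x
    assume T: "0 < T" "T \<le> 1"
      and x': "\<And>t. t \<in> {0..T} \<Longrightarrow> (x has_vector_derivative ham_vf H (x t)) (at t within {0..T})"
      and xT: "x T = Psi A (x 0)" and t: "t \<in> {0..T}"
    have vf: "ham_vf H z = (2 * f' (z \<bullet> z)) *\<^sub>R J z" for z
      unfolding H_def by (rule ham_vf_comp_inner_self[OF f(2)])
    define l where "l = 2 * f' (x 0 \<bullet> x 0)"
    have "x s \<bullet> x s = x 0 \<bullet> x 0" if "s \<in> {0..T}" for s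
      by (rule inner_self_constant_of_rotation[OF x'[unfolded vf] that])
    note const = this
    have "(x has_vector_derivative l *\<^sub>R J (x s)) (at s within {0..T})" if "s \<in> {0..T}" for s
      using x'[OF that] unfolding vf const[OF that] l_def .
    from rotation_flow_unique[OF this]
    have flow: "x s = cos (l * s) *\<^sub>R x 0 + sin (l * s) *\<^sub>R J (x 0)" if "s \<in> {0..T}" for s
      using that by blast
    show "x t = x 0"
    proof (cases "l = 0")
      case True
      then show ?thesis using flow[OF t] by simp
  next
      case False
      then have "0 < l" using f(3)[of "x 0 \<bullet> x 0"] by (simp add: l_def)
      have "l * T \<le> l * 1" using \<open>0 < l\<close> T(2) by (intro mult_left_mono) auto
      also have "\<dots> \<le> 2 * a" using f(4) by (simp add: l_def)
      finally have "l * T < tt (Psi A)" using a(2) by simp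
      moreover have "Psi A (x 0) = cos (l * T) *\<^sub>R x 0 + sin (l * T) *\<^sub>R J (x 0)"
        using flow[of T] xT T by simp
      \<comment> \<open>The total angle \<open>l * T\<close> lies strictly between 0 and
        \<open>tt (Psi A)\<close>, so the boundary condition leaves only the origin, a rest
        point.\<close>
      ultimately have "x 0 = 0"
        using no_rotation_eigenvector_below_tt[OF assms(1)] \<open>0 < l\<close> T(1) mult_pos_pos by blast
      moreover have "J (0 :: 'n phase) = 0" by (rule linear_0[OF linear_J])
      ultimately show ?thesis using flow[OF t] by simp
    qed
  qed
  ultimately have "ereal (ham_max W H) \<le> c_HZ (Psi A) W"
    unfolding c_HZ_def by (intro SUP_upper) auto
  moreover have "ereal (a * (1 - 4 * e)) \<le> ereal (ham_max W H)" using f(7) max by simp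
  ultimately show ?thesis unfolding a_def W_def by (rule order_trans[rotated])
qed

lemma c_HZ_ball_times_ball_ge:
  fixes A :: "real^'n^'n"
  assumes "invertible A"
  shows "ereal (tt (Psi A) / 2) \<le> c_HZ (Psi A) (ball 0 1 \<times> ball 0 1)"
proof (rule ccontr)
  define k where "k = tt (Psi A) / 2"
  have k: "k > 0" using tt_Psi_pos[OF assms] by (simp add: k_def)
  assume "\<not> ?thesis"
  then obtain y where y: "c_HZ (Psi A) (ball 0 1 \<times> ball 0 1) < ereal y" "y < k"
    using ereal_dense2[of "c_HZ (Psi A) (ball 0 1 \<times> ball 0 1)" "ereal k"] by (auto simp: k_def not_le)
  \<comment> \<open>Since \<open>(1 - e) * (1 - 4 * e) \<ge> 1 - 5 * e\<close>, the second bound on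
    \<open>e\<close> brings the approximation up to \<open>y\<close>; the first ensures
    \<open>4 * e < 1\<close>.\<close>
  define e where "e = min (1 / 8) ((k - y) / (5 * k))"
  have e: "0 < e" "4 * e < 1" "e \<le> (k - y) / (5 * k)"
    using k y(2) by (auto simp: e_def)
  from e(3) have "e * (5 * k) \<le> k - y" using k by (simp add: pos_le_divide_eq)
  then have "y \<le> k * (1 - 5 * e)" by (simp add: algebra_simps)
  also have "\<dots> \<le> k * ((1 - e) * (1 - 4 * e))"
    using k e(1) by (intro mult_left_mono) (auto simp: algebra_simps)
  finally have "ereal y \<le> ereal (tt (Psi A) / 2 * (1 - e) * (1 - 4 * e))"
    by (simp add: k_def mult.assoc)
  also have "\<dots> \<le> c_HZ (Psi A) (ball 0 1 \<times> ball 0 1)"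
    by (rule c_HZ_ball_times_ball_ge_approx[OF assms e(1,2)])
  finally show False using y(1) by simp
qed

section \<open>Affine embeddings: the inscribed ball and the circumscribed cylinder\<close>

lemma open_affine_image:
  fixes L :: "'a::euclidean_space \<Rightarrow> 'a"
  assumes "open W" "linear L" "\<And>z. L (M z) = z"
  shows "open ((\<lambda>z. L z + c) ` W)"
proof -
  have "surj L" using assms(3) by (metis surj_def)
  then have "open ((\<lambda>z. c + z) ` (L ` W))"
    using assms(1,2) open_surjective_linear_image open_translation by blast
  then show ?thesis by (simp add: image_image add.commute)
qed

lemma c_HZ_conformal_mono:
  fixes L M \<Psi> \<Psi>' :: "'n::finite phase \<Rightarrow> 'n phase" and c :: "'n phase"
  assumes "open W" "open W'" "linear L" "linear M" "\<And>z. M (L z) = z" "\<And>z. L (M z) = z"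
    and "\<And>z w. omega0 (L z) (L w) = \<kappa> * omega0 z w" "\<kappa> > 0"
    and "\<And>z. \<Psi>' (L z + c) = L (\<Psi> z) + c" "(\<lambda>z. L z + c) ` W \<subseteq> W'"
  shows "ereal \<kappa> * c_HZ \<Psi> W \<le> c_HZ \<Psi>' W'"
proof -
  have "open ((\<lambda>z. L z + c) ` W)" by (rule open_affine_image[OF assms(1,3,6)])
  then have "c_HZ \<Psi>' ((\<lambda>z. L z + c) ` W) \<le> c_HZ \<Psi>' W'"
    by (rule c_HZ_mono) fact+
  moreover have "ereal \<kappa> * c_HZ \<Psi> W \<le> c_HZ \<Psi>' ((\<lambda>z. L z + c) ` W)"
    by (rule c_HZ_conformal[where M = M])
      (use assms in \<open>auto simp: linear_conv_bounded_linear[symmetric]\<close>)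
  ultimately show ?thesis by (rule order_trans[rotated])
qed

lemma matrix_inv_eqI:
  fixes A :: "real^'n^'n"
  assumes "A ** B = mat 1"
  shows "matrix_inv A = B"
proof -
  have "B ** A = mat 1" using assms matrix_left_right_inverse by blast
  then have "invertible A" using assms unfolding invertible_def by blast
  then have "matrix_inv A = matrix_inv A ** (A ** B)" "matrix_inv A ** A = mat 1"
    using assms matrix_inv_works by auto
  then show ?thesis by (simp add: matrix_mul_assoc)
qed

lemma xi_eq: "xi A \<Delta> = c_HZ (Psi A) (interior \<Delta> \<times> ball 0 1)"
  by (simp add: xi_def c_EHZ_def interior_Times)

text \<open>Only the positions are scaled, so \<open>omega0\<close>, which pairs positions with
  momenta, is multiplied by \<open>r\<close> and not by \<open>r^2\<close>. The translation by
  \<open>qb\<close> is compatible with \<open>Psi A\<close> because \<open>A\<close> fixes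
  \<open>qb\<close>.\<close>

lemma xi_ge_of_ball_subset:
  fixes A :: "real^'n^'n"
  assumes "0 < r" "ball qb r \<subseteq> \<Delta>" "A *v qb = qb"
  shows "ereal r * c_EHZ (Psi A) (ball 0 1 \<times> ball 0 1) \<le> xi A \<Delta>"
proof -
  define L :: "'n phase \<Rightarrow> 'n phase" where "L = (\<lambda>(q, p). (r *\<^sub>R q, p))"
  define M :: "'n phase \<Rightarrow> 'n phase" where "M = (\<lambda>(q, p). (q /\<^sub>R r, p))"
  have "ereal r * c_HZ (Psi A) (ball 0 1 \<times> ball 0 1) \<le> c_HZ (Psi A) (interior \<Delta> \<times> ball 0 1)"
  proof (rule c_HZ_conformal_mono[where L = L and M = M and c = "(qb, 0)"])
    show "linear L" "linear M"
      by (auto intro!: linearI simp: L_def M_def scaleR_add_right)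
    show "Psi A (L z + (qb, 0)) = L (Psi A z) + (qb, 0)" for z
      using assms(3)
      by (cases z) (simp add: L_def Psi_def matrix_vector_right_distrib matrix_vector_mult_scaleR)
    have "ball qb r \<subseteq> interior \<Delta>" using assms(2) by (simp add: interior_maximal)
    moreover have "r *\<^sub>R q + qb \<in> ball qb r" if "norm q < 1" for q
      using that assms(1) by (simp add: dist_norm)
    ultimately show "(\<lambda>z. L z + (qb, 0)) ` (ball 0 1 \<times> ball 0 1) \<subseteq> interior \<Delta> \<times> ball 0 1"
      by (auto simp: L_def)
  qed (use assms(1) in \<open>auto simp: L_def M_def omega0_def algebra_simps intro: open_Times\<close>)
  then show ?thesis by (simp add: xi_eq c_EHZ_def interior_open open_Times)
qed

lemma inner_le_support_fun:
  assumes "compact \<Delta>" "x \<in> \<Delta>"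
  shows "x \<bullet> u \<le> support_fun \<Delta> u"
  unfolding support_fun_def
proof (rule cSUP_upper[OF assms(2)])
  show "bdd_above ((\<lambda>x. x \<bullet> u) ` \<Delta>)"
    using assms(1)
    by (intro bounded_imp_bdd_above compact_imp_bounded compact_continuous_image continuous_intros)
qed

lemma orthogonal_matrix_inner:
  fixes Q :: "real^'n^'n"
  assumes "orthogonal_matrix Q"
  shows "(Q *v x) \<bullet> (Q *v y) = x \<bullet> y"
  using assms
  by (metis inner_transpose_mult matrix_vector_mul_assoc matrix_vector_mul_lid orthogonal_matrix transpose_transpose)

lemma orthogonal_matrix_cancel:
  fixes Q :: "real^'n^'n"
  assumes "orthogonal_matrix Q"
  shows "transpose Q *v (Q *v x) = x" "Q *v (transpose Q *v x) = x"
  using assms by (simp_all add: orthogonal_matrix_def matrix_vector_mul_assoc)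

lemma inv_Psi_affine:
  assumes "orthogonal_matrix Q"
  shows "inv (Psi_affine Q qb) = (\<lambda>(q, v). (transpose Q *v q + qb, transpose Q *v v))"
  by (rule inv_equality) (auto simp: Psi_affine_def orthogonal_matrix_cancel[OF assms])

lemma Psi_orthogonal:
  assumes "orthogonal_matrix Q"
  shows "Psi Q = Psi_affine Q 0"
proof -
  have "matrix_inv (transpose Q) = Q"
    by (rule matrix_inv_eqI) (use assms in \<open>simp add: orthogonal_matrix_def\<close>)
  then show ?thesis by (simp add: Psi_def Psi_affine_def)
qed

text \<open>The conjugate could depend on \<open>qb\<close> only through
  \<open>Q *v (A *v qb - qb)\<close>, which vanishes; the resulting formula is free of
  \<open>qb\<close>.\<close>

lemma conj_Psi_affine:
  assumes "orthogonal_matrix Q" "A *v qb = qb"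
  shows "Psi_affine Q qb \<circ> Psi A \<circ> inv (Psi_affine Q qb)
    = (\<lambda>(q, v). (Q *v (A *v (transpose Q *v q)), Q *v (matrix_inv (transpose A) *v (transpose Q *v v))))"
  using assms(2) unfolding inv_Psi_affine[OF assms(1)]
  by (auto simp: Psi_affine_def Psi_def matrix_vector_right_distrib fun_eq_iff)

text \<open>Commutation passes from \<open>A\<close> to the momentum block in two stages:
  transposing and conjugating by the orthogonal \<open>Q\<close> gives it for
  \<open>transpose A\<close>, and multiplying by the inverse on both sides gives it for
  \<open>B\<close>.\<close>

lemma conj_Psi_affine_commuting:
  fixes A Q :: "real^'n^'n"
  assumes "orthogonal_matrix Q" "A *v qb = qb" "invertible A" "A ** Q = Q ** A"
  shows "Psi_affine Q qb \<circ> Psi A \<circ> inv (Psi_affine Q qb) = Psi A"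
proof -
  define B where "B = matrix_inv (transpose A)"
  have B: "B ** transpose A = mat 1" "transpose A ** B = mat 1"
    using matrix_inv_works[OF transpose_invertible[OF assms(3)]] by (auto simp: B_def)
  have Q: "Q ** transpose Q = mat 1" "transpose Q ** Q = mat 1"
    using assms(1) by (auto simp: orthogonal_matrix_def)
  have "transpose Q ** transpose A = transpose A ** transpose Q"
    using assms(4) by (metis matrix_transpose_mul)
  then have "Q ** (transpose Q ** transpose A) ** Q = Q ** (transpose A ** transpose Q) ** Q"
    by simp
  then have QA: "transpose A ** Q = Q ** transpose A"
    using Q by (metis matrix_mul_assoc matrix_mul_lid matrix_mul_rid)
  have "B ** (transpose A ** Q) ** B = B ** (Q ** transpose A) ** B"
    using QA by simp
  then have QB: "Q ** B = B ** Q"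
    using B by (metis matrix_mul_assoc matrix_mul_lid matrix_mul_rid)
  have "Q *v (A *v (transpose Q *v q)) = A *v q" for q
    using assms(4) orthogonal_matrix_cancel(2)[OF assms(1)] by (metis matrix_vector_mul_assoc)
  moreover have "Q *v (B *v (transpose Q *v v)) = B *v v" for v
    using QB orthogonal_matrix_cancel(2)[OF assms(1)] by (metis matrix_vector_mul_assoc)
  ultimately show ?thesis
    unfolding conj_Psi_affine[OF assms(1,2)] by (simp add: Psi_def B_def)
qed

text \<open>As \<open>Q\<close> is orthogonal and sends \<open>u\<close> to the chosen axis, that
  coordinate of \<open>Q *v x\<close> is \<open>x \<bullet> u\<close>. Centering at
  \<open>qb\<close> makes the slab of width \<open>width \<Delta>\<close> symmetric, and
  Cauchy-Schwarz bounds the momentum coordinate by 1.\<close>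

lemma xi_le_cylinder:
  fixes A Q :: "real^'n^'n"
  assumes "compact \<Delta>" "u \<in> width_directions \<Delta>" "qb \<in> mid_hyperplane \<Delta> u"
    and "orthogonal_matrix Q" "Q *v u = axis i1 1"
  shows "xi A \<Delta> \<le> c_EHZ (Psi_affine Q qb \<circ> Psi A \<circ> inv (Psi_affine Q qb)) (Z_cyl i1 \<Delta>)"
proof -
  define L :: "'n phase \<Rightarrow> 'n phase" where "L = (\<lambda>(q, p). (Q *v q, Q *v p))"
  define M :: "'n phase \<Rightarrow> 'n phase" where "M = (\<lambda>(q, p). (transpose Q *v q, transpose Q *v p))"
  define c :: "'n phase" where "c = (- (Q *v qb), 0)"
  define W where "W = interior \<Delta> \<times> ball (0 :: real^'n) 1"
  have oW: "open W" unfolding W_def by (intro open_Times) auto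
  have linL: "linear L" and linM: "linear M"
    by (auto intro!: linearI simp: L_def M_def matrix_vector_right_distrib matrix_vector_mult_scaleR)
  have inv_L: "M (L z) = z" "L (M z) = z" for z
    by (auto simp: L_def M_def orthogonal_matrix_cancel[OF assms(4)] split: prod.split)
  have aff: "Psi_affine Q qb = (\<lambda>z. L z + c)"
    by (auto simp: fun_eq_iff Psi_affine_def L_def c_def matrix_vector_mult_diff_distrib)
  have coord: "(Q *v x) $ i1 = x \<bullet> u" for x
    using orthogonal_matrix_inner[OF assms(4), of x u] by (simp add: assms(5) inner_axis)
  have "(\<lambda>z. L z + c) ` W \<subseteq> Z_cyl i1 \<Delta>"
  proof (rule image_subsetI)
    fix z assume "z \<in> W"
    then obtain q p where z: "z = (q, p)" and q: "q \<in> interior \<Delta>" and p: "norm p < 1"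
      by (auto simp: W_def)
    have qD: "q \<in> \<Delta>" using q interior_subset by blast
    have w: "width \<Delta> = support_fun \<Delta> u + support_fun \<Delta> (- u)" and nu: "norm u = 1"
      using assms(2) by (auto simp: width_directions_def)
    have qb: "qb \<bullet> u = (support_fun \<Delta> u - support_fun \<Delta> (- u)) / 2"
      using assms(3) by (simp add: mid_hyperplane_def)
    have "(q - qb) \<bullet> u \<in> {- width \<Delta> / 2..width \<Delta> / 2}"
      using inner_le_support_fun[OF assms(1) qD, of u] inner_le_support_fun[OF assms(1) qD, of "- u"]
      by (simp add: w qb inner_diff_left field_simps)
    moreover have "\<bar>p \<bullet> u\<bar> \<le> 1"
      using Cauchy_Schwarz_ineq2[of p u] p nu by simp
    ultimately have "Psi_affine Q qb z \<in> Z_cyl i1 \<Delta>"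
      by (simp add: z Psi_affine_def Z_cyl_def coord abs_le_iff)
    then show "L z + c \<in> Z_cyl i1 \<Delta>" by (simp add: aff)
  qed
  \<comment> \<open>\<open>c_EHZ\<close> sees only the interior of the closed cylinder; an open
    image contained in the cylinder lies in that interior.\<close>
  moreover have "open ((\<lambda>z. L z + c) ` W)"
    by (rule open_affine_image[OF oW linL inv_L(2)])
  ultimately have sub: "(\<lambda>z. L z + c) ` W \<subseteq> interior (Z_cyl i1 \<Delta>)"
    by (rule interior_maximal)
  have "ereal 1 * c_HZ (Psi A) W
    \<le> c_HZ (Psi_affine Q qb \<circ> Psi A \<circ> inv (Psi_affine Q qb)) (interior (Z_cyl i1 \<Delta>))"
  proof (rule c_HZ_conformal_mono[OF oW open_interior linL linM inv_L _ _ _ sub])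
    show "omega0 (L z) (L w) = 1 * omega0 z w" for z w
      by (cases z; cases w) (simp add: omega0_def L_def orthogonal_matrix_inner[OF assms(4)])
    have "inj (Psi_affine Q qb)"
      unfolding aff using inv_L(1) by (intro injI) (metis add_right_cancel)
    then show "(Psi_affine Q qb \<circ> Psi A \<circ> inv (Psi_affine Q qb)) (L z + c) = L (Psi A z) + c" for z
      using inv_f_f[of "Psi_affine Q qb" z] by (simp add: aff)
  qed auto
  then show ?thesis by (simp add: xi_eq c_EHZ_def W_def one_ereal_def[symmetric])
qed

theorem proposition1p10:
  fixes A :: "real^'n^'n" and \<Delta> :: "(real^'n) set" and i1 :: 'n
  assumes "invertible A"
    and "convex_body \<Delta>"
    and "Fix ((*v) A) \<inter> interior \<Delta> \<noteq> {}"
  shows "(\<forall>qb r. r > 0 \<and> ball qb r \<subseteq> \<Delta> \<and> A *v qb = qb \<longrightarrow>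
            xi A \<Delta> \<ge> ereal r * c_EHZ (Psi A) (ball 0 1 \<times> ball 0 1) \<and>
            ereal r * c_EHZ (Psi A) (ball 0 1 \<times> ball 0 1) \<ge> ereal (r * tt (Psi A) / 2)) \<and>
         (\<forall>u\<in>width_directions \<Delta>. \<forall>qb\<in>mid_hyperplane \<Delta> u. \<forall>Q :: real^'n^'n.
            orthogonal_matrix Q \<and> Q *v u = axis i1 1 \<longrightarrow>
            xi A \<Delta> \<le> c_EHZ (Psi_affine Q qb \<circ> Psi A \<circ> inv (Psi_affine Q qb)) (Z_cyl i1 \<Delta>) \<and>
            (A *v qb = qb \<longrightarrow>
               c_EHZ (Psi_affine Q qb \<circ> Psi A \<circ> inv (Psi_affine Q qb)) (Z_cyl i1 \<Delta>)
               = c_EHZ (Psi Q \<circ> Psi A \<circ> inv (Psi Q)) (Z_cyl i1 \<Delta>)) \<and>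
            (A *v qb = qb \<and> A ** Q = Q ** A \<longrightarrow>
               c_EHZ (Psi_affine Q qb \<circ> Psi A \<circ> inv (Psi_affine Q qb)) (Z_cyl i1 \<Delta>)
               = c_EHZ (Psi A) (Z_cyl i1 \<Delta>)))"
proof (intro conjI allI ballI impI; (elim conjE)?)
  fix qb r assume "r > 0" "ball qb r \<subseteq> \<Delta>" "A *v qb = qb"
  then show "ereal r * c_EHZ (Psi A) (ball 0 1 \<times> ball 0 1) \<le> xi A \<Delta>"
    by (rule xi_ge_of_ball_subset)
next
  fix qb and r :: real assume r: "r > 0"
  have "ereal r * ereal (tt (Psi A) / 2) \<le> ereal r * c_HZ (Psi A) (ball 0 1 \<times> ball 0 1)"
    using c_HZ_ball_times_ball_ge[OF assms(1)] r by (intro ereal_mult_left_mono) auto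
  then show "ereal (r * tt (Psi A) / 2) \<le> ereal r * c_EHZ (Psi A) (ball 0 1 \<times> ball 0 1)"
    by (simp add: c_EHZ_def interior_open open_Times)
next
  fix u qb and Q :: "real^'n^'n"
  assume "u \<in> width_directions \<Delta>" "qb \<in> mid_hyperplane \<Delta> u" "orthogonal_matrix Q" "Q *v u = axis i1 1"
  then show "xi A \<Delta> \<le> c_EHZ (Psi_affine Q qb \<circ> Psi A \<circ> inv (Psi_affine Q qb)) (Z_cyl i1 \<Delta>)"
    using assms(2) by (intro xi_le_cylinder) (auto simp: convex_body_def)
next
  fix qb and Q :: "real^'n^'n"
  assume Q: "orthogonal_matrix Q" and qb: "A *v qb = qb"
  show "c_EHZ (Psi_affine Q qb \<circ> Psi A \<circ> inv (Psi_affine Q qb)) (Z_cyl i1 \<Delta>)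
      = c_EHZ (Psi Q \<circ> Psi A \<circ> inv (Psi Q)) (Z_cyl i1 \<Delta>)"
    \<comment> \<open>\<open>Psi Q\<close> is the affine map with base point 0, which
      \<open>A\<close> also fixes, so both conjugates are given by the same formula.\<close>
    unfolding Psi_orthogonal[OF Q] conj_Psi_affine[OF Q qb]
    by (simp add: conj_Psi_affine[OF Q])
next
  fix qb and Q :: "real^'n^'n"
  assume "orthogonal_matrix Q" "A *v qb = qb" "A ** Q = Q ** A"
  then show "c_EHZ (Psi_affine Q qb \<circ> Psi A \<circ> inv (Psi_affine Q qb)) (Z_cyl i1 \<Delta>)
      = c_EHZ (Psi A) (Z_cyl i1 \<Delta>)"
    by (simp add: conj_Psi_affine_commuting[OF _ _ assms(1)])
qed

end
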